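(* Let $k$ be a field and $L$ a finite dimensional Hopf algebra over $k$. Then there exists an isomorphism of Hopf algebras $$L\cong P(\mathcal{H}(L),\mathcal{R}),$$ where $\mathcal{R}\in\mathcal{H}(L)\otimes\mathcal{H}(L)$ is the canonical element of the Heisenberg double $\mathcal{H}(L)$.
   Context: All algebras (associative, unital), Hopf algebras and tensor products are over $k$. For a finite dimensional Hopf algebra $L$, $L^*$ carries the convolution product, and $L$ acts on $L^*$ by $\langle h\cdot g^*,h'\rangle=\langle g^*,h'h\rangle$. The Heisenberg double $\mathcal{H}(L)=L\#L^*$ is $L\otimes L^*$ as a vector space, with multiplication $(h\#h^* )(g\#g^* )=h_{(2)}g\#h^*(h_{(1)}\cdot g^* )$ (Sweedler notation) and unit $1_L\#\varepsilon_L$. Its canonical element is $\mathcal{R}=\sum_i(e_i\#\varepsilon_L)\otimes(1_L\#e_i^* )$, where $\{e_i\}$, $\{e_i^*\}$ are dual bases of $L$ and $L^*$; it is an invertible solution of the pentagon equation $\mathcal{R}^{12}\mathcal{R}^{13}\mathcal{R}^{23}=\mathcal{R}^{23}\mathcal{R}^{12}$ (where for $R=\sum R^1\otimes R^2\in A\otimes A$ one sets $R^{12}=\sum R^1\otimes R^2\otimes 1$, $R^{13}=\sum R^1\otimes 1\otimes R^2$, $R^{23}=\sum 1\otimes R^1\otimes R^2$). For a finite dimensional algebra $A$ and an invertible solution $R=\sum R^1\otimes R^2\in A\otimes A$ of the pentagon equation, $P(A,R)=R_{(l)}=\{\sum\langle a^*,R^2\rangle R^1\mid a^*\in A^*\}$;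 it is a unital subalgebra of $A$ and a Hopf algebra with comultiplication $\Delta_P(x)=R^{-1}(1_A\otimes x)R$. Explicitly, if $R=\sum_{i=1}^m a_i\otimes b_i$ with $m$ minimal, $\{b_i^*\}$ is the dual basis to $\{b_i\}$ (on the span of the $b_i$) and $R^{-1}=\sum U^1\otimes U^2$, then $\{a_i\}$ is a basis of $P(A,R)$, its counit is $\varepsilon_P(a_i)=\langle b_i^*,1_A\rangle$ and its antipode is $S_P(a_i)=\sum U^1\langle b_i^*,U^2\rangle$. *)

theory Defs
  imports Complex_Main "HOL-Library.Function_Algebras"
begin

section \<open>Vector spaces over a field\<close>

text \<open>
  A vector space is a subspace \<open>carr V\<close> of an ambient type carrying a scalar multiplication
  \<open>smul V\<close>.  Keeping the carrier explicit allows the spaces \<open>V\<^sup>*\<close>, \<open>V \<otimes> W\<close> and \<open>P(A,R)\<close> to be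
  formed inside the logic.  Function types carry the pointwise addition of
  \<^theory>\<open>HOL-Library.Function_Algebras\<close>.
\<close>

record ('k, 'a) vspace =
  carr :: "'a set"
  smul :: "'k \<Rightarrow> 'a \<Rightarrow> 'a"

definition is_vspace :: "('k::field, 'a::ab_group_add, 'm) vspace_scheme \<Rightarrow> bool" where
  "is_vspace V \<longleftrightarrow> vector_space (smul V) \<and> module.subspace (smul V) (carr V)"

definition finite_dim :: "('k::field, 'a::ab_group_add, 'm) vspace_scheme \<Rightarrow> bool" where
  "finite_dim V \<longleftrightarrow> (\<exists>B. finite B \<and> module.span (smul V) B = carr V)"

definition basis_of :: "('k::field, 'a::ab_group_add, 'm) vspace_scheme \<Rightarrow> 'a set \<Rightarrow> bool" where
  "basis_of V B \<longleftrightarrow> \<not> module.dependent (smul V) B \<and> module.span (smul V) B = carr V"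

definition base_field :: "('k::field, 'k) vspace" where
  "base_field = \<lparr>carr = UNIV, smul = (*)\<rparr>"

definition lin_map :: "('k::field, 'a::ab_group_add, 'm) vspace_scheme \<Rightarrow>
    ('k, 'b::ab_group_add, 'n) vspace_scheme \<Rightarrow> ('a \<Rightarrow> 'b) \<Rightarrow> bool" where
  "lin_map V W f \<longleftrightarrow>
     (\<forall>x\<in>carr V. f x \<in> carr W) \<and>
     (\<forall>x\<in>carr V. \<forall>y\<in>carr V. f (x + y) = f x + f y) \<and>
     (\<forall>c. \<forall>x\<in>carr V. f (smul V c x) = smul W c (f x))"

definition bilin_map :: "('k::field, 'a::ab_group_add, 'm) vspace_scheme \<Rightarrow>
    ('k, 'b::ab_group_add, 'n) vspace_scheme \<Rightarrow> ('k, 'c::ab_group_add, 'p) vspace_scheme \<Rightarrow>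
    ('a \<Rightarrow> 'b \<Rightarrow> 'c) \<Rightarrow> bool" where
  "bilin_map V W U f \<longleftrightarrow>
     (\<forall>x\<in>carr V. lin_map W U (f x)) \<and> (\<forall>y\<in>carr W. lin_map V U (\<lambda>x. f x y))"

definition fun_smul :: "'k::field \<Rightarrow> ('i \<Rightarrow> 'k) \<Rightarrow> 'i \<Rightarrow> 'k" where
  "fun_smul c f = (\<lambda>x. c * f x)"

text \<open>Maps on a carrier are represented by functions that vanish outside the carrier.\<close>

definition on_carr :: "('k, 'a, 'm) vspace_scheme \<Rightarrow> ('a \<Rightarrow> 'b::zero) \<Rightarrow> 'a \<Rightarrow> 'b" where
  "on_carr V f = (\<lambda>x. if x \<in> carr V then f x else 0)"

definition dual :: "('k::field, 'a::ab_group_add, 'm) vspace_scheme \<Rightarrow> ('k, 'a \<Rightarrow> 'k) vspace" where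
  "dual V = \<lparr>carr = {f. lin_map V base_field f \<and> (\<forall>x. x \<notin> carr V \<longrightarrow> f x = 0)}, smul = fun_smul\<rparr>"


section \<open>Tensor products\<close>

text \<open>
  \<open>V \<otimes> W\<close> is realised as the span of the evaluations \<open>v \<otimes> w = (B \<mapsto> B v w)\<close> in the dual of the
  space of bilinear forms on the ambient spaces; the lemma \<open>tlift_tsum\<close> below is its universal
  property.  As \<open>v \<otimes> w\<close> depends on the ambient spaces only, \<open>V' \<otimes> W'\<close> is literally a subset of
  \<open>V \<otimes> W\<close> for subspaces \<open>V'\<close> of \<open>V\<close> and \<open>W'\<close> of \<open>W\<close>.
\<close>

type_synonym ('k, 'a, 'b) tensor = "('a \<Rightarrow> 'b \<Rightarrow> 'k) \<Rightarrow> 'k"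

definition bilin_form :: "('k::field, 'a::ab_group_add, 'm) vspace_scheme \<Rightarrow>
    ('k, 'b::ab_group_add, 'n) vspace_scheme \<Rightarrow> ('a \<Rightarrow> 'b \<Rightarrow> 'k) \<Rightarrow> bool" where
  "bilin_form V W B \<longleftrightarrow>
     (\<forall>x. Vector_Spaces.linear (smul W) (*) (B x)) \<and>
     (\<forall>y. Vector_Spaces.linear (smul V) (*) (\<lambda>x. B x y))"

definition pure :: "('k::field, 'a::ab_group_add, 'm) vspace_scheme \<Rightarrow>
    ('k, 'b::ab_group_add, 'n) vspace_scheme \<Rightarrow> 'a \<Rightarrow> 'b \<Rightarrow> ('k, 'a, 'b) tensor" where
  "pure V W x y = (\<lambda>B. if bilin_form V W B then B x y else 0)"

definition tensor :: "('k::field, 'a::ab_group_add, 'm) vspace_scheme \<Rightarrow>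
    ('k, 'b::ab_group_add, 'n) vspace_scheme \<Rightarrow> ('k, ('k, 'a, 'b) tensor) vspace" where
  "tensor V W = \<lparr>carr = module.span fun_smul {pure V W x y | x y. x \<in> carr V \<and> y \<in> carr W},
                 smul = fun_smul\<rparr>"

definition tsum :: "('k::field, 'a::ab_group_add, 'm) vspace_scheme \<Rightarrow>
    ('k, 'b::ab_group_add, 'n) vspace_scheme \<Rightarrow> ('a \<times> 'b) list \<Rightarrow> ('k, 'a, 'b) tensor" where
  "tsum V W xs = (\<Sum>(x, y)\<leftarrow>xs. pure V W x y)"

definition decomp :: "('k::field, 'a::ab_group_add, 'm) vspace_scheme \<Rightarrow>
    ('k, 'b::ab_group_add, 'n) vspace_scheme \<Rightarrow> ('k, 'a, 'b) tensor \<Rightarrow> ('a \<times> 'b) list \<Rightarrow> bool" where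
  "decomp V W t xs \<longleftrightarrow> set xs \<subseteq> carr V \<times> carr W \<and> t = tsum V W xs"

text \<open>
  \<open>tlift V W f\<close> is the linear map \<open>V \<otimes> W \<rightarrow> U\<close> induced by a bilinear map \<open>f : V \<times> W \<rightarrow> U\<close>; in the
  usual sumless notation, \<open>tlift V W f t\<close> is \<open>\<Sum> f t\<^sup>1 t\<^sup>2\<close> for \<open>t = \<Sum> t\<^sup>1 \<otimes> t\<^sup>2\<close>.  By
  \<open>tlift_tsum\<close> the choice of the representation of \<open>t\<close> is irrelevant.
\<close>

definition tlift :: "('k::field, 'a::ab_group_add, 'm) vspace_scheme \<Rightarrow>
    ('k, 'b::ab_group_add, 'n) vspace_scheme \<Rightarrow> ('a \<Rightarrow> 'b \<Rightarrow> 'c::comm_monoid_add) \<Rightarrow>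
    ('k, 'a, 'b) tensor \<Rightarrow> 'c" where
  "tlift V W f t = (\<Sum>(x, y)\<leftarrow>(SOME xs. decomp V W t xs). f x y)"

lemma tsum_zero_lift_zero:
  fixes V :: "('k::field, 'a::ab_group_add, 'm) vspace_scheme"
    and W :: "('k, 'b::ab_group_add, 'n) vspace_scheme"
    and U :: "('k, 'c::ab_group_add, 'p) vspace_scheme"
  assumes V: "is_vspace V" and W: "is_vspace W" and U: "is_vspace U"
    and f: "bilin_map V W U f"
    and xs: "set xs \<subseteq> carr V \<times> carr W" and z: "tsum V W xs = 0"
  shows "(\<Sum>(x, y)\<leftarrow>xs. f x y) = 0"
proof -
  interpret v: vector_space "smul V" using V by (simp add: is_vspace_def)
  interpret w: vector_space "smul W" using W by (simp add: is_vspace_def)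
  interpret u: vector_space "smul U" using U by (simp add: is_vspace_def)
  have sV: "v.subspace (carr V)" and sW: "w.subspace (carr W)"
    using V W by (simp_all add: is_vspace_def)
  obtain E where E: "E \<subseteq> carr V" "\<not> v.dependent E" "carr V \<subseteq> v.span E"
    by (rule v.maximal_independent_subset)
  define E' where "E' = v.extend_basis E"
  have E': "E \<subseteq> E'" "\<not> v.dependent E'" "v.span E' = UNIV"
    using E(2) by (simp_all add: E'_def v.extend_basis_superset v.independent_extend_basis)
  obtain D where D: "\<not> w.dependent D" "w.span D = UNIV"
    using w.maximal_independent_subset[of UNIV] by (metis top.extremum_uniqueI)
  define r where "r x e = v.representation E' x e" for x e
  define q where "q y d = w.representation D y d" for y d
  have r_lin: "Vector_Spaces.linear (smul V) (*) (\<lambda>x. r x e)" for e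
    unfolding r_def by (rule v.linear_representation[OF E'(2,3)])
  have q_lin: "Vector_Spaces.linear (smul W) (*) (\<lambda>y. q y d)" for d
    unfolding q_def by (rule w.linear_representation[OF D])
  have r_E: "r x = v.representation E x" if "x \<in> carr V" for x
    using v.representation_extend[OF E'(2) _ E'(1)] that E(3) by (auto simp: r_def fun_eq_iff)
  define F where "F = (\<Union>x\<in>fst ` set xs. {e. r x e \<noteq> 0})"
  have finF: "finite F"
    unfolding F_def r_def by (intro finite_UN_I finite_imageI v.finite_representation) auto
  have FE: "F \<subseteq> E"
    using xs r_E v.representation_ne_zero[of E] by (fastforce simp: F_def)
  have expand: "x = (\<Sum>e\<in>F. smul V (r x e) e)" if "x \<in> fst ` set xs" for x
  proof -
    have "{e. r x e \<noteq> 0} \<subseteq> F" using that by (auto simp: F_def)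
    then have "(\<Sum>e\<in>F. smul V (r x e) e) = (\<Sum>e | r x e \<noteq> 0. smul V (r x e) e)"
      by (intro sum.mono_neutral_right finF) auto
    also have "\<dots> = x"
      unfolding r_def by (rule v.sum_nonzero_representation_eq[OF E'(2)]) (simp add: E'(3))
    finally show ?thesis by simp
  qed
  define zz where "zz e = (\<Sum>(x, y)\<leftarrow>xs. smul W (r x e) y)" for e
  have q_sum: "q (\<Sum>(x, y)\<leftarrow>ys. smul W (r x e) y) d = (\<Sum>(x, y)\<leftarrow>ys. r x e * q y d)" for ys e d
  proof (induction ys)
    case Nil
    then show ?case by (simp add: q_def w.representation_zero)
  next
    case (Cons p ys)
    then show ?case
      using q_lin[of d] by (cases p) (simp add: Vector_Spaces.linear_iff)
  qed
  have bil: "bilin_form V W (\<lambda>x y. r x e * q y d)" for e d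
    using r_lin[of e] q_lin[of d]
    by (simp add: bilin_form_def Vector_Spaces.linear_iff algebra_simps)
  have ev: "tsum V W ys B = (\<Sum>(x, y)\<leftarrow>ys. pure V W x y B)" for ys B
    by (induction ys) (auto simp: tsum_def)
  have "(\<Sum>(x, y)\<leftarrow>xs. r x e * q y d) = 0" for e d
    using ev[of xs "\<lambda>x y. r x e * q y d"] z bil[of e d]
    by (simp add: pure_def cong: map_cong)
  then have "q (zz e) d = 0" for e d
    unfolding zz_def by (simp add: q_sum)
  then have zz0: "zz e = 0" for e
    using w.sum_nonzero_representation_eq[OF D(1), of "zz e"] D(2) by (simp add: q_def)
  have f1: "lin_map W U (f x)" if "x \<in> carr V" for x
    using f that by (simp add: bilin_map_def)
  have f2: "lin_map V U (\<lambda>x. f x y)" if "y \<in> carr W" for y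
    using f that by (simp add: bilin_map_def)
  have f_sum: "f (\<Sum>e\<in>G. smul V (c e) e) y = (\<Sum>e\<in>G. f e (smul W (c e) y))"
    if "finite G" "G \<subseteq> carr V" "y \<in> carr W" for G c y
    using that(1,2)
  proof (induction G rule: finite_induct)
    case empty
    have "f (smul V 0 0) y = smul U 0 (f 0 y)"
      using f2[OF that(3)] v.subspace_0[OF sV] unfolding lin_map_def by blast
    then show ?case by simp
  next
    case (insert e G)
    have *: "smul V (c e) e \<in> carr V" "(\<Sum>e\<in>G. smul V (c e) e) \<in> carr V" "e \<in> carr V"
      using insert sV by (auto intro!: v.subspace_scale v.subspace_sum)
    have "f (smul V (c e) e) y = smul U (c e) (f e y)"
      using f2[OF that(3)] * unfolding lin_map_def by blast
    also have "\<dots> = f e (smul W (c e) y)"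
      using f1[OF *(3)] that(3) unfolding lin_map_def by simp
    finally show ?case
      using insert f2[OF that(3)] * unfolding lin_map_def by simp
  qed
  have f_zz: "(\<Sum>(x, y)\<leftarrow>ys. f e (smul W (r x e) y)) = f e (\<Sum>(x, y)\<leftarrow>ys. smul W (r x e) y)
      \<and> (\<Sum>(x, y)\<leftarrow>ys. smul W (r x e) y) \<in> carr W"
    if "e \<in> carr V" "set ys \<subseteq> carr V \<times> carr W" for e ys
    using that(2)
  proof (induction ys)
    case Nil
    have "f e (smul W 0 0) = smul U 0 (f e 0)"
      using f1[OF that(1)] w.subspace_0[OF sW] unfolding lin_map_def by blast
    then show ?case by (simp add: w.subspace_0[OF sW])
  next
    case (Cons p ys)
    obtain x y where p: "p = (x, y)" by (cases p)
    have "smul W (r x e) y \<in> carr W"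
      using Cons.prems p sW by (auto intro: w.subspace_scale)
    then show ?case
      using Cons p f1[OF that(1)] sW unfolding lin_map_def by (auto intro: w.subspace_add)
  qed
  have "(\<Sum>(x, y)\<leftarrow>xs. f x y) = (\<Sum>(x, y)\<leftarrow>xs. \<Sum>e\<in>F. f e (smul W (r x e) y))"
  proof (intro arg_cong[where f = sum_list] map_cong refl, clarify)
    fix x y assume xy: "(x, y) \<in> set xs"
    then have "x \<in> fst ` set xs" by force
    from expand[OF this] have "f x y = f (\<Sum>e\<in>F. smul V (r x e) e) y" by simp
    also have "\<dots> = (\<Sum>e\<in>F. f e (smul W (r x e) y))"
      using f_sum[OF finF] FE E(1) xs xy by blast
    finally show "f x y = (\<Sum>e\<in>F. f e (smul W (r x e) y))" .
  qed
  also have "\<dots> = (\<Sum>e\<in>F. \<Sum>(x, y)\<leftarrow>xs. f e (smul W (r x e) y))"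
    by (induction xs) (auto simp: sum.distrib)
  also have "\<dots> = (\<Sum>e\<in>F. f e (zz e))"
    using f_zz[OF _ xs] FE E(1) by (intro sum.cong) (auto simp: zz_def)
  also have "\<dots> = (\<Sum>e\<in>F. f e (smul W 0 0))"
    by (simp add: zz0)
  also have "\<dots> = 0"
  proof (intro sum.neutral ballI)
    fix e assume "e \<in> F"
    then have "e \<in> carr V" using FE E(1) by blast
    from f1[OF this] show "f e (smul W 0 0) = 0"
      using w.subspace_0[OF sW] unfolding lin_map_def by (metis u.scale_zero_left)
  qed
  finally show ?thesis .
qed

lemma tlift_tsum:
  fixes V :: "('k::field, 'a::ab_group_add, 'm) vspace_scheme"
    and W :: "('k, 'b::ab_group_add, 'n) vspace_scheme"
    and U :: "('k, 'c::ab_group_add, 'p) vspace_scheme"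
  assumes V: "is_vspace V" and W: "is_vspace W" and U: "is_vspace U"
    and f: "bilin_map V W U f"
    and xs: "set xs \<subseteq> carr V \<times> carr W"
  shows "tlift V W f (tsum V W xs) = (\<Sum>(x, y)\<leftarrow>xs. f x y)"
proof -
  interpret v: vector_space "smul V" using V by (simp add: is_vspace_def)
  interpret u: vector_space "smul U" using U by (simp add: is_vspace_def)
  have sV: "v.subspace (carr V)" using V by (simp add: is_vspace_def)
  define ys where "ys = (SOME ys. decomp V W (tsum V W xs) ys)"
  have "decomp V W (tsum V W xs) xs" using xs by (simp add: decomp_def)
  then have "decomp V W (tsum V W xs) ys" unfolding ys_def by (rule someI)
  then have ys: "set ys \<subseteq> carr V \<times> carr W" "tsum V W ys = tsum V W xs"
    by (simp_all add: decomp_def)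
  define ns where "ns = map (\<lambda>(x, y). (- x, y)) xs"
  have ns: "set ns \<subseteq> carr V \<times> carr W"
    using xs v.subspace_neg[OF sV] by (auto simp: ns_def)
  have pure_neg: "pure V W (- x) y = - pure V W x y" for x y
  proof
    fix B
    show "pure V W (- x) y B = (- pure V W x y) B"
    proof (cases "bilin_form V W B")
      case True
      then have "Vector_Spaces.linear (smul V) (*) (\<lambda>x. B x y)"
        by (simp add: bilin_form_def)
      then have "B (smul V (- 1) x) y = (- 1) * B x y"
        unfolding Vector_Spaces.linear_iff by blast
      then show ?thesis using True by (simp add: pure_def)
    qed (simp add: pure_def)
  qed
  have tneg: "tsum V W ns = - tsum V W xs"
    unfolding ns_def by (induction xs) (auto simp: tsum_def pure_neg)
  have fneg: "(\<Sum>(x, y)\<leftarrow>ns. f x y) = - (\<Sum>(x, y)\<leftarrow>xs. f x y)"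
    using xs unfolding ns_def
  proof (induction xs)
    case (Cons p xs)
    obtain x y where p: "p = (x, y)" by (cases p)
    then have "lin_map V U (\<lambda>x. f x y)" "x \<in> carr V"
      using f Cons.prems by (auto simp: bilin_map_def)
    then have "f (smul V (- 1) x) y = smul U (- 1) (f x y)"
      unfolding lin_map_def by blast
    then show ?case using Cons p by simp
  qed simp
  have "tsum V W (ys @ ns) = 0"
    using ys(2) tneg by (simp add: tsum_def)
  from tsum_zero_lift_zero[OF V W U f _ this] ys(1) ns
  have "(\<Sum>(x, y)\<leftarrow>ys. f x y) + (\<Sum>(x, y)\<leftarrow>ns. f x y) = 0" by simp
  then show ?thesis
    by (simp add: tlift_def ys_def[symmetric] fneg)
qed


section \<open>Algebras and Hopf algebras\<close>

record ('k, 'a) kalg = "('k, 'a) vspace" +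
  mul :: "'a \<Rightarrow> 'a \<Rightarrow> 'a"
  munit :: 'a

record ('k, 'a) hopf = "('k, 'a) kalg" +
  comul :: "'a \<Rightarrow> ('k, 'a, 'a) tensor"
  counit :: "'a \<Rightarrow> 'k"
  antipode :: "'a \<Rightarrow> 'a"

definition tensor_alg :: "('k::field, 'a::ab_group_add, 'm) kalg_scheme \<Rightarrow>
    ('k, 'b::ab_group_add, 'n) kalg_scheme \<Rightarrow> ('k, ('k, 'a, 'b) tensor) kalg" where
  "tensor_alg A B = \<lparr>carr = carr (tensor A B), smul = smul (tensor A B),
     mul = (\<lambda>s t. tlift A B (\<lambda>a b. tlift A B (\<lambda>a' b'. pure A B (mul A a a') (mul B b b')) t) s),
     munit = pure A B (munit A) (munit B)\<rparr>"

locale k_algebra =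
  fixes A :: "('k::field, 'a::ab_group_add, 'm) kalg_scheme"
  assumes vspace: "is_vspace A"
    and mul_bilin: "bilin_map A A A (mul A)"
    and mul_assoc: "\<lbrakk>x \<in> carr A; y \<in> carr A; z \<in> carr A\<rbrakk> \<Longrightarrow>
          mul A (mul A x y) z = mul A x (mul A y z)"
    and munit_closed: "munit A \<in> carr A"
    and munit_left: "x \<in> carr A \<Longrightarrow> mul A (munit A) x = x"
    and munit_right: "x \<in> carr A \<Longrightarrow> mul A x (munit A) = x"

text \<open>Both sides of \<open>coassoc\<close> live in \<open>H \<otimes> (H \<otimes> H)\<close>.\<close>

locale hopf_algebra = k_algebra H
  for H :: "('k::field, 'a::ab_group_add, 'm) hopf_scheme" +
  assumes comul_lin: "lin_map H (tensor H H) (comul H)"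
    and counit_lin: "lin_map H base_field (counit H)"
    and coassoc: "h \<in> carr H \<Longrightarrow>
          tlift H H (\<lambda>x z. tlift H H (\<lambda>x1 x2. pure H (tensor H H) x1 (pure H H x2 z)) (comul H x))
            (comul H h)
          = tlift H H (\<lambda>x z. pure H (tensor H H) x (comul H z)) (comul H h)"
    and counit_left: "h \<in> carr H \<Longrightarrow> tlift H H (\<lambda>x y. smul H (counit H x) y) (comul H h) = h"
    and counit_right: "h \<in> carr H \<Longrightarrow> tlift H H (\<lambda>x y. smul H (counit H y) x) (comul H h) = h"
    and comul_mul: "\<lbrakk>g \<in> carr H; h \<in> carr H\<rbrakk> \<Longrightarrow>
          comul H (mul H g h) = mul (tensor_alg H H) (comul H g) (comul H h)"
    and comul_munit: "comul H (munit H) = munit (tensor_alg H H)"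
    and counit_mul: "\<lbrakk>g \<in> carr H; h \<in> carr H\<rbrakk> \<Longrightarrow>
          counit H (mul H g h) = counit H g * counit H h"
    and counit_munit: "counit H (munit H) = 1"
    and antipode_lin: "lin_map H H (antipode H)"
    and antipode_left: "h \<in> carr H \<Longrightarrow>
          tlift H H (\<lambda>x y. mul H (antipode H x) y) (comul H h) = smul H (counit H h) (munit H)"
    and antipode_right: "h \<in> carr H \<Longrightarrow>
          tlift H H (\<lambda>x y. mul H x (antipode H y)) (comul H h) = smul H (counit H h) (munit H)"

definition hopf_iso :: "('k::field, 'a::ab_group_add, 'm) hopf_scheme \<Rightarrow>
    ('k, 'b::ab_group_add, 'n) hopf_scheme \<Rightarrow> ('a \<Rightarrow> 'b) \<Rightarrow> bool" where
  "hopf_iso H K f \<longleftrightarrow>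
     lin_map H K f \<and> bij_betw f (carr H) (carr K) \<and>
     (\<forall>x\<in>carr H. \<forall>y\<in>carr H. f (mul H x y) = mul K (f x) (f y)) \<and>
     f (munit H) = munit K \<and>
     (\<forall>x\<in>carr H. comul K (f x) = tlift H H (\<lambda>u v. pure K K (f u) (f v)) (comul H x)) \<and>
     (\<forall>x\<in>carr H. counit K (f x) = counit H x) \<and>
     (\<forall>x\<in>carr H. antipode K (f x) = f (antipode H x))"


section \<open>The Heisenberg double\<close>

definition conv :: "('k::field, 'a::ab_group_add, 'm) hopf_scheme \<Rightarrow>
    ('a \<Rightarrow> 'k) \<Rightarrow> ('a \<Rightarrow> 'k) \<Rightarrow> 'a \<Rightarrow> 'k" where
  "conv L \<phi> \<psi> = on_carr L (\<lambda>h. tlift L L (\<lambda>x y. \<phi> x * \<psi> y) (comul L h))"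

definition dual_act :: "('k::field, 'a::ab_group_add, 'm) hopf_scheme \<Rightarrow>
    'a \<Rightarrow> ('a \<Rightarrow> 'k) \<Rightarrow> 'a \<Rightarrow> 'k" where
  "dual_act L h \<psi> = on_carr L (\<lambda>h'. \<psi> (mul L h' h))"

text \<open>The element \<open>h # \<phi>\<close> of \<open>L # L\<^sup>*\<close> is \<open>pure L (dual L) h \<phi>\<close>.\<close>

definition heisenberg :: "('k::field, 'a::ab_group_add, 'm) hopf_scheme \<Rightarrow>
    ('k, ('k, 'a, 'a \<Rightarrow> 'k) tensor) kalg" where
  "heisenberg L = \<lparr>carr = carr (tensor L (dual L)), smul = smul (tensor L (dual L)),
     mul = (\<lambda>s t.
       tlift L (dual L) (\<lambda>h \<phi>.
         tlift L (dual L) (\<lambda>g \<psi>.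
           tlift L L (\<lambda>h1 h2. pure L (dual L) (mul L h2 g) (conv L \<phi> (dual_act L h1 \<psi>)))
             (comul L h)) t) s),
     munit = pure L (dual L) (munit L) (on_carr L (counit L))\<rparr>"

text \<open>
  For a basis \<open>B\<close> of \<open>L\<close> and \<open>e \<in> B\<close>, the functional \<open>e\<^sup>*\<close> of the dual basis is the coordinate
  function \<open>x \<mapsto> representation B x e\<close>, which vanishes outside \<open>span B = carr L\<close>.
\<close>

definition canonical_element :: "('k::field, 'a::ab_group_add, 'm) hopf_scheme \<Rightarrow>
    ('k, ('k, 'a, 'a \<Rightarrow> 'k) tensor, ('k, 'a, 'a \<Rightarrow> 'k) tensor) tensor" where
  "canonical_element L =
     (let B = (SOME B. basis_of L B) in
      \<Sum>e\<in>B. pure (heisenberg L) (heisenberg L)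
               (pure L (dual L) e (on_carr L (counit L)))
               (pure L (dual L) (munit L) (\<lambda>x. module.representation (smul L) B x e)))"


section \<open>The Hopf algebra of an invertible solution of the pentagon equation\<close>

definition tensor_inv :: "('k::field, 'a::ab_group_add, 'm) kalg_scheme \<Rightarrow>
    ('k, 'a, 'a) tensor \<Rightarrow> ('k, 'a, 'a) tensor" where
  "tensor_inv A R = (THE U. U \<in> carr (tensor A A) \<and>
     mul (tensor_alg A A) R U = munit (tensor_alg A A) \<and>
     mul (tensor_alg A A) U R = munit (tensor_alg A A))"

definition left_leg :: "('k::field, 'a::ab_group_add, 'm) kalg_scheme \<Rightarrow>
    ('k, 'a, 'a) tensor \<Rightarrow> ('k, 'a) vspace" where
  "left_leg A R = \<lparr>carr = {tlift A A (\<lambda>r1 r2. smul A (\<alpha> r2) r1) R | \<alpha>. \<alpha> \<in> carr (dual A)},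
                   smul = smul A\<rparr>"

definition min_decomp :: "('k::field, 'a::ab_group_add, 'm) vspace_scheme \<Rightarrow>
    ('k, 'a, 'a) tensor \<Rightarrow> ('a \<times> 'a) list \<Rightarrow> bool" where
  "min_decomp A R xs \<longleftrightarrow> decomp A A R xs \<and> (\<forall>ys. decomp A A R ys \<longrightarrow> length xs \<le> length ys)"

text \<open>
  Let \<open>R = \<Sum> a\<^sub>i \<otimes> b\<^sub>i\<close> with the number of summands minimal.  The dual basis \<open>b\<^sub>i\<^sup>*\<close> consists of
  functionals on the span of the \<open>b\<^sub>i\<close>.  Here it is given by arbitrary extensions to \<open>A\<close>, so that
  \<open>b\<^sub>i\<^sup>*\<close> can be applied to an arbitrary representation of \<open>R\<^sup>-\<^sup>1\<close>; for an invertible solution of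
  the pentagon equation, \<open>1 \<in> span {b\<^sub>i}\<close> and \<open>R\<^sup>-\<^sup>1 \<in> A \<otimes> span {b\<^sub>i}\<close>, so the values do not depend
  on the extensions.
\<close>

definition dual_family :: "('k::field, 'a::ab_group_add, 'm) vspace_scheme \<Rightarrow>
    'a list \<Rightarrow> ('a \<Rightarrow> 'k) list \<Rightarrow> bool" where
  "dual_family A bs \<beta>s \<longleftrightarrow> length \<beta>s = length bs \<and> set \<beta>s \<subseteq> carr (dual A) \<and>
     (\<forall>i<length bs. \<forall>j<length bs. (\<beta>s ! i) (bs ! j) = (if i = j then 1 else 0))"

text \<open>
  Counit and antipode are the linear maps with the prescribed values on the basis \<open>a\<^sub>i\<close>, for
  every minimal decomposition of \<open>R\<close>.
\<close>

definition P_counit :: "('k::field, 'a::ab_group_add, 'm) kalg_scheme \<Rightarrow>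
    ('k, 'a, 'a) tensor \<Rightarrow> 'a \<Rightarrow> 'k" where
  "P_counit A R = (THE e. lin_map (left_leg A R) base_field e \<and>
     (\<forall>x. x \<notin> carr (left_leg A R) \<longrightarrow> e x = 0) \<and>
     (\<forall>xs \<beta>s. min_decomp A R xs \<and> dual_family A (map snd xs) \<beta>s \<longrightarrow>
        (\<forall>i<length xs. e (fst (xs ! i)) = (\<beta>s ! i) (munit A))))"

definition P_antipode :: "('k::field, 'a::ab_group_add, 'm) kalg_scheme \<Rightarrow>
    ('k, 'a, 'a) tensor \<Rightarrow> 'a \<Rightarrow> 'a" where
  "P_antipode A R = (THE S. lin_map (left_leg A R) A S \<and>
     (\<forall>x. x \<notin> carr (left_leg A R) \<longrightarrow> S x = 0) \<and>
     (\<forall>xs \<beta>s. min_decomp A R xs \<and> dual_family A (map snd xs) \<beta>s \<longrightarrow>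
        (\<forall>i<length xs. S (fst (xs ! i)) =
           tlift A A (\<lambda>u1 u2. smul A ((\<beta>s ! i) u2) u1) (tensor_inv A R))))"

definition P_hopf :: "('k::field, 'a::ab_group_add, 'm) kalg_scheme \<Rightarrow>
    ('k, 'a, 'a) tensor \<Rightarrow> ('k, 'a) hopf" where
  "P_hopf A R = \<lparr>carr = carr (left_leg A R), smul = smul A, mul = mul A, munit = munit A,
     comul = (\<lambda>x. mul (tensor_alg A A)
        (mul (tensor_alg A A) (tensor_inv A R) (pure A A (munit A) x)) R),
     counit = P_counit A R,
     antipode = P_antipode A R\<rparr>"

end

theory Submission
  imports Defs
begin

text \<open>
  Write \<open>A = L # L\<^sup>*\<close>.  Both \<open>incl : h \<mapsto> h # \<epsilon>\<close> and \<open>dincl : \<phi> \<mapsto> 1 # \<phi>\<close> are injective algebra maps into \<open>A\<close>,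
  and they satisfy \<open>h \<phi> = \<Sum> (h\<^sub>(\<^sub>1\<^sub>) \<cdot> \<phi>) h\<^sub>(\<^sub>2\<^sub>)\<close>.  The isomorphism is \<open>incl\<close>.

  Sending a linear map \<open>F : L \<rightarrow> L\<close> to \<open>canon F = \<Sum> F(e) \<otimes> e\<^sup>*\<close>, for a basis of vectors \<open>e\<close>, turns the
  convolution product of \<open>Hom(L,L)\<close> into the product of \<open>A \<otimes> A\<close> (\<open>canon_mul\<close>).  The canonical element \<open>R\<close> is
  the image of the identity, so its inverse is the image of the antipode \<open>S\<close> (\<open>R_inverse\<close>).  Comparing the
  linear maps that belong to the two sides also shows \<open>(1 \<otimes> h) R = R \<Delta>(h)\<close> (\<open>R_intertwines\<close>), that
  is, \<open>R\<^sup>-\<^sup>1 (1 \<otimes> h) R = \<Delta>(h)\<close>: the comultiplication of \<open>P(A,R)\<close> is that of \<open>L\<close>.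

  Applying \<open>id \<otimes> \<alpha>\<close> to \<open>canon F\<close>, for a functional \<open>\<alpha>\<close> on \<open>A\<close>, gives \<open>F(v)\<close>, where the vector \<open>v\<close> of \<open>L\<close>
  corresponds to the restriction of \<open>\<alpha>\<close> to \<open>L\<^sup>*\<close> (\<open>slice_canon\<close>).  For \<open>F = id\<close> this shows that the left leg
  of \<open>R\<close> is the copy of \<open>L\<close>.  If \<open>R = \<Sum> a\<^sub>n \<otimes> b\<^sub>n\<close> with dual functionals \<open>\<beta>\<^sub>n\<close>, then \<open>a\<^sub>n\<close> is the vector
  that belongs to \<open>\<beta>\<^sub>n\<close>, and so \<open>\<beta>\<^sub>n(1) = \<epsilon>(a\<^sub>n)\<close>, while \<open>id \<otimes> \<beta>\<^sub>n\<close> maps \<open>R\<^sup>-\<^sup>1 = canon S\<close> to \<open>S(a\<^sub>n)\<close>: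
  counit and antipode of \<open>P(A,R)\<close> are those of \<open>L\<close> as well (\<open>the_map_on_leg\<close>).

  All operations of \<open>P(A,R)\<close> are therefore images of those of \<open>L\<close>, and the Hopf algebra axioms are
  inherited (\<open>hopf_algebra_transport\<close>).  What has to be proved about \<open>A\<close> itself is that it is an associative
  algebra (\<open>k_algebra_heisenberg\<close>); this makes \<open>R\<^sup>-\<^sup>1\<close> unique.
\<close>

section \<open>Vector spaces\<close>

text \<open>
  Tensors and functionals are functions themselves.  Sums of them must stay opaque to the simplifier,
  or else they are unfolded into lambda abstractions to which linearity rules no longer apply.
\<close>

lemmas fun_arith = plus_fun_apply zero_fun_apply
declare fun_arith [simp del]

lemma vector_space_fun_smul: "vector_space (fun_smul :: 'k::field \<Rightarrow> ('i \<Rightarrow> 'k) \<Rightarrow> 'i \<Rightarrow> 'k)"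
  by unfold_locales (auto simp: fun_smul_def fun_eq_iff fun_arith algebra_simps)

lemma is_vspaceD:
  assumes "is_vspace V"
  shows "vector_space (smul V)" "module.subspace (smul V) (carr V)"
  using assms by (simp_all add: is_vspace_def)

lemma vspace_closed:
  assumes "is_vspace V"
  shows "0 \<in> carr V"
    and "x \<in> carr V \<Longrightarrow> y \<in> carr V \<Longrightarrow> x + y \<in> carr V"
    and "x \<in> carr V \<Longrightarrow> smul V c x \<in> carr V"
    and "(\<And>i. i \<in> I \<Longrightarrow> g i \<in> carr V) \<Longrightarrow> sum g I \<in> carr V"
    and "(\<And>z. z \<in> set zs \<Longrightarrow> h z \<in> carr V) \<Longrightarrow> sum_list (map h zs) \<in> carr V"
proof -
  interpret v: vector_space "smul V" using assms by (rule is_vspaceD)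
  note s = is_vspaceD(2)[OF assms]
  show "0 \<in> carr V" by (rule v.subspace_0[OF s])
  show add: "x + y \<in> carr V" if "x \<in> carr V" "y \<in> carr V" for x y
    by (rule v.subspace_add[OF s that])
  show "x \<in> carr V \<Longrightarrow> smul V c x \<in> carr V" by (rule v.subspace_scale[OF s])
  show "(\<And>i. i \<in> I \<Longrightarrow> g i \<in> carr V) \<Longrightarrow> sum g I \<in> carr V" by (rule v.subspace_sum[OF s])
  show "(\<And>z. z \<in> set zs \<Longrightarrow> h z \<in> carr V) \<Longrightarrow> sum_list (map h zs) \<in> carr V"
    by (induction zs) (auto intro: add v.subspace_0[OF s])
qed

lemma is_vspace_base_field: "is_vspace (base_field :: ('k::field, 'k) vspace)"
proof -
  interpret vector_space "(*) :: 'k \<Rightarrow> 'k \<Rightarrow> 'k"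
    by unfold_locales (auto simp: algebra_simps)
  show ?thesis
    using vector_space_axioms by (simp add: is_vspace_def base_field_def)
qed

lemma base_field_simps [simp]: "carr base_field = UNIV" "smul base_field = (*)"
  by (simp_all add: base_field_def)

lemma smul_simps:
  assumes "vector_space (smul V)"
  shows "smul V c (x + y) = smul V c x + smul V c y"
    and "smul V (a + b) x = smul V a x + smul V b x"
    and "smul V a (smul V b x) = smul V (a * b) x"
    and "smul V 1 x = x"
    and "smul V 0 x = 0"
    and "smul V c 0 = 0"
proof -
  interpret v: vector_space "smul V" by (rule assms)
  show "smul V c (x + y) = smul V c x + smul V c y" by (rule v.scale_right_distrib)
  show "smul V (a + b) x = smul V a x + smul V b x" by (rule v.scale_left_distrib)
  show "smul V a (smul V b x) = smul V (a * b) x" "smul V 1 x = x"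
    "smul V 0 x = 0" "smul V c 0 = 0" by simp_all
qed

lemma smul_sum_list:
  assumes "vector_space (smul V)"
  shows "smul V c (sum_list (map f xs)) = sum_list (map (\<lambda>x. smul V c (f x)) xs)"
  by (induction xs) (simp_all add: smul_simps[OF assms])

lemma smul_sum:
  assumes "vector_space (smul V)"
  shows "smul V c (sum f I) = (\<Sum>i\<in>I. smul V c (f i))"
    "smul V (sum g I) x = (\<Sum>i\<in>I. smul V (g i) x)"
proof -
  interpret v: vector_space "smul V" by (rule assms)
  show "smul V c (sum f I) = (\<Sum>i\<in>I. smul V c (f i))" by (rule v.scale_sum_right)
  show "smul V (sum g I) x = (\<Sum>i\<in>I. smul V (g i) x)" by (rule v.scale_sum_left)
qed

section \<open>Linear maps between carriers\<close>

lemma lin_mapI: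
  assumes "\<And>x. x \<in> carr V \<Longrightarrow> f x \<in> carr W"
    and "\<And>x y. x \<in> carr V \<Longrightarrow> y \<in> carr V \<Longrightarrow> f (x + y) = f x + f y"
    and "\<And>c x. x \<in> carr V \<Longrightarrow> f (smul V c x) = smul W c (f x)"
  shows "lin_map V W f"
  using assms by (simp add: lin_map_def)

lemma lin_mapD:
  assumes "lin_map V W f"
  shows "x \<in> carr V \<Longrightarrow> f x \<in> carr W"
    and "x \<in> carr V \<Longrightarrow> y \<in> carr V \<Longrightarrow> f (x + y) = f x + f y"
    and "x \<in> carr V \<Longrightarrow> f (smul V c x) = smul W c (f x)"
  using assms by (simp_all add: lin_map_def)

lemma lin_map_zero:
  assumes "lin_map V W f" "is_vspace V"
  shows "f 0 = 0"
proof -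
  have "f (0 + 0) = f 0 + f 0"
    using assms by (intro lin_mapD(2)[OF assms(1)] vspace_closed)
  then show ?thesis by simp
qed

lemma lin_map_sum_list:
  assumes "lin_map V W f" "is_vspace V" "\<And>z. z \<in> set zs \<Longrightarrow> g z \<in> carr V"
  shows "f (sum_list (map g zs)) = sum_list (map (\<lambda>z. f (g z)) zs)"
  using assms(3)
  by (induction zs) (simp_all add: lin_map_zero[OF assms(1,2)] lin_mapD(2)[OF assms(1)]
      vspace_closed[OF assms(2)])

lemma lin_map_sum:
  assumes "lin_map V W f" "is_vspace V" "\<And>i. i \<in> I \<Longrightarrow> g i \<in> carr V"
  shows "f (sum g I) = (\<Sum>i\<in>I. f (g i))"
  using assms(3)
  by (induction I rule: infinite_finite_induct)
    (simp_all add: lin_map_zero[OF assms(1,2)] lin_mapD(2)[OF assms(1)] vspace_closed[OF assms(2)])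

lemma lin_map_compose:
  "lin_map V W f \<Longrightarrow> lin_map W U g \<Longrightarrow> lin_map V U (\<lambda>x. g (f x))"
  by (simp add: lin_map_def)

lemma lin_map_id: "lin_map V V (\<lambda>x. x)"
  by (simp add: lin_map_def)

lemma bilin_mapI:
  assumes "\<And>x. x \<in> carr V \<Longrightarrow> lin_map W U (f x)"
    and "\<And>y. y \<in> carr W \<Longrightarrow> lin_map V U (\<lambda>x. f x y)"
  shows "bilin_map V W U f"
  using assms by (simp add: bilin_map_def)

lemma bilin_mapD:
  assumes "bilin_map V W U f"
  shows "x \<in> carr V \<Longrightarrow> lin_map W U (f x)"
    and "y \<in> carr W \<Longrightarrow> lin_map V U (\<lambda>x. f x y)"
  using assms by (simp_all add: bilin_map_def)

lemma bilin_map_pre: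
  assumes "bilin_map V W U f" "lin_map V' V g" "lin_map W' W h"
  shows "bilin_map V' W' U (\<lambda>x y. f (g x) (h y))"
  using assms by (simp add: bilin_map_def lin_map_def)

section \<open>Tensor products\<close>

lemma bilin_formD:
  assumes "bilin_form V W B"
  shows "B (x + x') y = B x y + B x' y" "B x (y + y') = B x y + B x y'"
    "B (smul V c x) y = c * B x y" "B x (smul W c y) = c * B x y"
  using assms by (auto simp: bilin_form_def Vector_Spaces.linear_iff)

lemma pure_bilinear:
  shows pure_add_left: "pure V W (x + x') y = pure V W x y + pure V W x' y"
    and pure_add_right: "pure V W x (y + y') = pure V W x y + pure V W x y'"
    and pure_smul_left: "pure V W (smul V c x) y = fun_smul c (pure V W x y)"
    and pure_smul_right: "pure V W x (smul W c y) = fun_smul c (pure V W x y)"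
  by (auto simp: pure_def fun_smul_def fun_eq_iff fun_arith bilin_formD)

lemma tensor_simps [simp]: "smul (tensor V W) = fun_smul"
  by (simp add: tensor_def)

lemma module_fun_smul: "module (fun_smul :: 'k::field \<Rightarrow> ('i \<Rightarrow> 'k) \<Rightarrow> 'i \<Rightarrow> 'k)"
  by (simp add: module_iff_vector_space vector_space_fun_smul)

lemma is_vspace_tensor: "is_vspace (tensor V W)"
  by (simp add: is_vspace_def tensor_def vector_space_fun_smul module.subspace_span[OF module_fun_smul])

lemma pure_closed: "x \<in> carr V \<Longrightarrow> y \<in> carr W \<Longrightarrow> pure V W x y \<in> carr (tensor V W)"
  by (auto simp: tensor_def intro!: module.span_base[OF module_fun_smul])

lemma bilin_map_pure: "bilin_map V W (tensor V W) (pure V W)"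
  by (intro bilin_mapI lin_mapI) (simp_all add: pure_bilinear pure_closed)

text \<open>
  A scalar can be moved into the first tensor factor, so linear combinations of pure tensors are sums of
  pure tensors.
\<close>

lemma decomp_exists:
  assumes V: "is_vspace V" and t: "t \<in> carr (tensor V W)"
  shows "\<exists>xs. decomp V W t xs"
proof -
  from t have "t \<in> module.span fun_smul {pure V W x y | x y. x \<in> carr V \<and> y \<in> carr W}"
    by (simp add: tensor_def)
  then show ?thesis
  proof (induction rule: module.span_induct_alt[OF module_fun_smul, consumes 1, case_names base step])
    case base
    have "decomp V W 0 []" by (simp add: decomp_def tsum_def)
    then show ?case by blast
  next
    case (step c p t)
    then obtain x y xs where p: "p = pure V W x y" "x \<in> carr V" "y \<in> carr W"
      and xs: "decomp V W t xs" by blast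
    have "decomp V W (fun_smul c p + t) ((smul V c x, y) # xs)"
      using p xs vspace_closed(3)[OF V]
      by (auto simp: decomp_def tsum_def pure_smul_left)
    then show ?case by blast
  qed
qed

text \<open>
  The representation chosen in the definition of \<open>tlift\<close>.  By writing \<open>tlift V W f t\<close> as a sum
  over this list, everything that only concerns finite sums (interchange, additivity, evaluation at a
  point) holds for arbitrary \<open>f\<close>; bilinearity only matters when \<open>t\<close> itself is varied.
\<close>

definition rep where "rep V W t = (SOME xs. decomp V W t xs)"

lemma tlift_rep: "tlift V W f t = (\<Sum>(x, y)\<leftarrow>rep V W t. f x y)"
  by (simp add: tlift_def rep_def)

lemma decomp_rep:
  assumes "is_vspace V" "t \<in> carr (tensor V W)"
  shows "decomp V W t (rep V W t)"
  unfolding rep_def by (rule someI_ex[OF decomp_exists[OF assms]])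

lemma rep_carr:
  assumes "is_vspace V" "t \<in> carr (tensor V W)" "z \<in> set (rep V W t)"
  shows "fst z \<in> carr V" "snd z \<in> carr W"
  using decomp_rep[OF assms(1,2)] assms(3) by (auto simp: decomp_def)

lemma tensor_induct [consumes 3, case_names pure add]:
  assumes V: "is_vspace V" and W: "is_vspace W" and t: "t \<in> carr (tensor V W)"
    and pure: "\<And>x y. x \<in> carr V \<Longrightarrow> y \<in> carr W \<Longrightarrow> P (pure V W x y)"
    and add: "\<And>s t. s \<in> carr (tensor V W) \<Longrightarrow> t \<in> carr (tensor V W) \<Longrightarrow> P s \<Longrightarrow> P t \<Longrightarrow> P (s + t)"
  shows "P t"
proof -
  have p0: "pure V W 0 0 = 0"
    using pure_add_left[of V W 0 0 0] by simp
  have "P (tsum V W xs) \<and> tsum V W xs \<in> carr (tensor V W)"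
    if "set xs \<subseteq> carr V \<times> carr W" for xs
    using that
  proof (induction xs)
    case Nil
    have "tsum V W [] = pure V W 0 0"
      unfolding p0 by (simp add: tsum_def)
    then show ?case
      by (simp add: pure pure_closed vspace_closed(1)[OF V] vspace_closed(1)[OF W])
  next
    case (Cons z xs)
    then show ?case
      by (cases z) (auto simp: tsum_def intro!: add pure pure_closed vspace_closed(2)[OF is_vspace_tensor])
  qed
  with decomp_exists[OF V t] show ?thesis by (auto simp: decomp_def)
qed

lemma tlift_pure:
  assumes "is_vspace V" "is_vspace W" "is_vspace U" "bilin_map V W U f" "x \<in> carr V" "y \<in> carr W"
  shows "tlift V W f (pure V W x y) = f x y"
  using tlift_tsum[OF assms(1-4), of "[(x, y)]"] assms(5,6) by (simp add: tsum_def)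

text \<open>
  Two lists representing \<open>s\<close> and \<open>t\<close> concatenate to one representing \<open>s + t\<close>, and
  \<open>tlift_tsum\<close> makes the value independent of the list.
\<close>

lemma lin_map_tlift:
  assumes V: "is_vspace V" and W: "is_vspace W" and U: "is_vspace U"
    and f: "bilin_map V W U f"
  shows "lin_map (tensor V W) U (tlift V W f)"
proof (rule lin_mapI)
  note T = tlift_tsum[OF V W U f]
  fix s assume s: "s \<in> carr (tensor V W)"
  obtain xs where xs: "set xs \<subseteq> carr V \<times> carr W" "s = tsum V W xs"
    using decomp_exists[OF V s] by (auto simp: decomp_def)
  have fc: "f x y \<in> carr U" if "x \<in> carr V" "y \<in> carr W" for x y
    using lin_mapD(1)[OF bilin_mapD(1)[OF f]] that by blast
  show "tlift V W f s \<in> carr U"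
    using xs by (auto simp: T intro!: vspace_closed(5)[OF U] fc)
  show "tlift V W f (s + t) = tlift V W f s + tlift V W f t" if t: "t \<in> carr (tensor V W)" for t
  proof -
    obtain ys where ys: "set ys \<subseteq> carr V \<times> carr W" "t = tsum V W ys"
      using decomp_exists[OF V t] by (auto simp: decomp_def)
    have "s + t = tsum V W (xs @ ys)" by (simp add: tsum_def xs ys)
    then show ?thesis using T[of "xs @ ys"] T[of xs] T[of ys] xs ys by simp
  qed
  fix c
  define zs where "zs = map (\<lambda>(x, y). (smul V c x, y)) xs"
  have zs: "set zs \<subseteq> carr V \<times> carr W"
    using xs(1) by (auto simp: zs_def intro: vspace_closed(3)[OF V])
  have cs: "fun_smul c s = tsum V W zs"
    unfolding xs(2) zs_def
    by (induction xs) (auto simp: tsum_def pure_smul_left fun_smul_def fun_eq_iff fun_arith algebra_simps)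
  have fz: "(\<Sum>(x, y)\<leftarrow>zs. f x y) = smul U c (\<Sum>(x, y)\<leftarrow>xs. f x y)"
    using xs(1) unfolding zs_def
    by (induction xs) (auto simp: smul_simps[OF is_vspaceD(1)[OF U]] lin_mapD(3)[OF bilin_mapD(2)[OF f]])
  show "tlift V W f (smul (tensor V W) c s) = smul U c (tlift V W f s)"
    using T[OF zs] T[OF xs(1)] fz cs xs(2) by simp
qed

lemma tlift_cong:
  assumes "is_vspace V" "t \<in> carr (tensor V W)"
    "\<And>x y. x \<in> carr V \<Longrightarrow> y \<in> carr W \<Longrightarrow> f x y = g x y"
  shows "tlift V W f t = tlift V W g t"
  unfolding tlift_rep using rep_carr[OF assms(1,2)] assms(3)
  by (intro arg_cong[where f = sum_list] map_cong) auto

lemma tlift_closed: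
  assumes "is_vspace V" "is_vspace U" "t \<in> carr (tensor V W)"
    "\<And>x y. x \<in> carr V \<Longrightarrow> y \<in> carr W \<Longrightarrow> f x y \<in> carr U"
  shows "tlift V W f t \<in> carr U"
  unfolding tlift_rep using rep_carr[OF assms(1,3)] assms(4)
  by (intro vspace_closed(5)[OF assms(2)]) auto

lemma lin_map_apply_tlift:
  assumes F: "lin_map U X F" and U: "is_vspace U" and V: "is_vspace V"
    and t: "t \<in> carr (tensor V W)"
    and f: "\<And>x y. x \<in> carr V \<Longrightarrow> y \<in> carr W \<Longrightarrow> f x y \<in> carr U"
  shows "F (tlift V W f t) = tlift V W (\<lambda>x y. F (f x y)) t"
  unfolding tlift_rep using rep_carr[OF V t] f
  by (subst lin_map_sum_list[OF F U]) (auto simp: case_prod_unfold)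

lemma tlift_swap:
  fixes f :: "_ \<Rightarrow> _ \<Rightarrow> _ \<Rightarrow> _ \<Rightarrow> 'c::comm_monoid_add"
  shows "tlift V W (\<lambda>x y. tlift X Y (\<lambda>u v. f x y u v) s) t = tlift X Y (\<lambda>u v. tlift V W (\<lambda>x y. f x y u v) t) s"
proof -
  have *: "sum_list (map (\<lambda>a. sum_list (map (\<lambda>b. g a b) bs)) as) =
      sum_list (map (\<lambda>b. sum_list (map (\<lambda>a. g a b) as)) bs)" for g :: "_ \<Rightarrow> _ \<Rightarrow> 'c::comm_monoid_add" and as bs
    by (induction as) (simp_all add: sum_list_addf)
  show ?thesis
    unfolding tlift_rep case_prod_unfold by (rule *)
qed

lemma tlift_add:
  "tlift V W (\<lambda>x y. f x y + g x y) t = tlift V W f t + tlift V W g t"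
  by (simp add: tlift_rep case_prod_unfold sum_list_addf)

lemma tlift_smul:
  "vector_space (smul U) \<Longrightarrow> tlift V W (\<lambda>x y. smul U c (f x y)) t = smul U c (tlift V W f t)"
  by (simp add: tlift_rep case_prod_unfold smul_sum_list)

lemma tlift_sum:
  fixes f :: "_ \<Rightarrow> _ \<Rightarrow> _ \<Rightarrow> 'c::comm_monoid_add"
  shows "tlift V W (\<lambda>x y. \<Sum>i\<in>I. f i x y) t = (\<Sum>i\<in>I. tlift V W (f i) t)"
proof -
  have "sum_list (map (\<lambda>z. \<Sum>i\<in>I. g i z) zs) = (\<Sum>i\<in>I. sum_list (map (g i) zs))"
    for g :: "_ \<Rightarrow> _ \<Rightarrow> 'c::comm_monoid_add" and zs
    by (induction zs) (simp_all add: sum.distrib)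
  then show ?thesis by (simp add: tlift_rep case_prod_unfold)
qed

lemma tlift_apply: "tlift V W f t z = tlift V W (\<lambda>x y. f x y z) t"
proof -
  have "sum_list (map g zs) z = sum_list (map (\<lambda>a. g a z) zs)" for g and zs
    by (induction zs) (simp_all add: fun_arith)
  then show ?thesis by (simp add: tlift_rep case_prod_unfold)
qed

lemma lin_map_tlift_param:
  assumes "is_vspace V" "is_vspace U" "t \<in> carr (tensor V W)"
    and "\<And>v w. v \<in> carr V \<Longrightarrow> w \<in> carr W \<Longrightarrow> lin_map X U (\<lambda>x. f x v w)"
  shows "lin_map X U (\<lambda>x. tlift V W (f x) t)"
proof (rule lin_mapI)
  note l = lin_mapD[OF assms(4)]
  show "tlift V W (f x) t \<in> carr U" if "x \<in> carr X" for x
    using that by (intro tlift_closed assms(1-3) l)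
  show "tlift V W (f (x + y)) t = tlift V W (f x) t + tlift V W (f y) t"
    if "x \<in> carr X" "y \<in> carr X" for x y
    unfolding tlift_add[symmetric] using that by (intro tlift_cong assms(1-3)) (simp add: l)
  show "tlift V W (f (smul X c x)) t = smul U c (tlift V W (f x) t)"
    if "x \<in> carr X" for c x
    unfolding tlift_smul[OF is_vspaceD(1)[OF assms(2)], symmetric]
    using that by (intro tlift_cong assms(1-3)) (simp add: l)
qed

definition multilin4 where
  "multilin4 V W X Y U m \<longleftrightarrow>
     (\<forall>x\<in>carr X. \<forall>y\<in>carr Y. bilin_map V W U (\<lambda>v w. m v w x y)) \<and>
     (\<forall>v\<in>carr V. \<forall>w\<in>carr W. bilin_map X Y U (\<lambda>x y. m v w x y))"

text \<open>
  The products of \<open>A \<otimes> A\<close> and of the Heisenberg double are both of this shape: a map that is linear in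
  each of four arguments, extended to a bilinear map on two tensor products.
\<close>

lemma double_tlift:
  assumes V: "is_vspace V" and W: "is_vspace W" and X: "is_vspace X" and Y: "is_vspace Y"
    and U: "is_vspace U" and m: "multilin4 V W X Y U m"
  shows "bilin_map (tensor V W) (tensor X Y) U (\<lambda>s t. tlift V W (\<lambda>v w. tlift X Y (m v w) t) s)"
    and "v \<in> carr V \<Longrightarrow> w \<in> carr W \<Longrightarrow> x \<in> carr X \<Longrightarrow> y \<in> carr Y \<Longrightarrow>
      tlift V W (\<lambda>v w. tlift X Y (m v w) (pure X Y x y)) (pure V W v w) = m v w x y"
proof -
  let ?F = "\<lambda>s t. tlift V W (\<lambda>v w. tlift X Y (m v w) t) s"
  have m1: "bilin_map X Y U (m v w)" if "v \<in> carr V" "w \<in> carr W" for v w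
    using m that by (simp add: multilin4_def)
  have m2: "bilin_map V W U (\<lambda>v w. m v w x y)" if "x \<in> carr X" "y \<in> carr Y" for x y
    using m that by (simp add: multilin4_def)
  have bi: "bilin_map V W U (\<lambda>v w. tlift X Y (m v w) t)" if "t \<in> carr (tensor X Y)" for t
  proof (rule bilin_mapI)
    show "lin_map W U (\<lambda>w. tlift X Y (m v w) t)" if "v \<in> carr V" for v
      by (rule lin_map_tlift_param[OF X U \<open>t \<in> _\<close>]) (rule bilin_mapD(1)[OF m2 that])
    show "lin_map V U (\<lambda>v. tlift X Y (m v w) t)" if "w \<in> carr W" for w
      by (rule lin_map_tlift_param[OF X U \<open>t \<in> _\<close>]) (rule bilin_mapD(2)[OF m2 that])
  qed
  show "bilin_map (tensor V W) (tensor X Y) U ?F"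
  proof (rule bilin_mapI)
    show "lin_map (tensor X Y) U (?F s)" if "s \<in> carr (tensor V W)" for s
      by (rule lin_map_tlift_param[OF V U that]) (rule lin_map_tlift[OF X Y U m1])
    show "lin_map (tensor V W) U (\<lambda>s. ?F s t)" if "t \<in> carr (tensor X Y)" for t
      by (rule lin_map_tlift[OF V W U bi[OF that]])
  qed
  have a: "?F (pure V W v w) t = tlift X Y (m v w) t"
    if "v \<in> carr V" "w \<in> carr W" "t \<in> carr (tensor X Y)" for v w t
    by (rule tlift_pure[OF V W U bi[OF that(3)] that(1,2)])
  show "?F (pure V W v w) (pure X Y x y) = m v w x y"
    if "v \<in> carr V" "w \<in> carr W" "x \<in> carr X" "y \<in> carr Y" for v w x y
    using that by (simp add: a pure_closed tlift_pure[OF X Y U m1])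
qed

section \<open>The algebra structure on tensors\<close>

context k_algebra
begin

lemma mul_closed: "x \<in> carr A \<Longrightarrow> y \<in> carr A \<Longrightarrow> mul A x y \<in> carr A"
  using mul_bilin by (simp add: bilin_map_def lin_map_def)

lemma mul_lin_left: "y \<in> carr A \<Longrightarrow> lin_map A A (\<lambda>x. mul A x y)"
  and mul_lin_right: "x \<in> carr A \<Longrightarrow> lin_map A A (\<lambda>y. mul A x y)"
  using mul_bilin by (simp_all add: bilin_map_def)

lemma mul_linear:
  assumes "x \<in> carr A" "y \<in> carr A"
  shows "z \<in> carr A \<Longrightarrow> mul A (x + z) y = mul A x y + mul A z y"
    and "z \<in> carr A \<Longrightarrow> mul A x (y + z) = mul A x y + mul A x z"
    and "mul A (smul A c x) y = smul A c (mul A x y)"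
    and "mul A x (smul A c y) = smul A c (mul A x y)"
  using mul_bilin assms by (simp_all add: bilin_map_def lin_map_def)

lemma multilin4_tensor_mul:
  "multilin4 A A A A (tensor A A) (\<lambda>a b a' b'. pure A A (mul A a a') (mul A b b'))"
  unfolding multilin4_def
  by (intro conjI ballI bilin_map_pre[OF bilin_map_pure] mul_lin_left mul_lin_right)

lemma tensor_alg_simps:
  "carr (tensor_alg A A) = carr (tensor A A)"
  "smul (tensor_alg A A) = fun_smul"
  "munit (tensor_alg A A) = pure A A (munit A) (munit A)"
  by (simp_all add: tensor_alg_def)

lemma tensor_alg_mul:
  "mul (tensor_alg A A) s t = tlift A A (\<lambda>a b. tlift A A (\<lambda>a' b'. pure A A (mul A a a') (mul A b b')) t) s"
  by (simp add: tensor_alg_def)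

lemma tensor_alg_mul_bilin:
  "bilin_map (tensor A A) (tensor A A) (tensor A A) (mul (tensor_alg A A))"
  unfolding tensor_alg_mul
  by (rule double_tlift(1)[OF vspace vspace vspace vspace is_vspace_tensor multilin4_tensor_mul])

lemma tensor_alg_mul_pure:
  assumes "a \<in> carr A" "b \<in> carr A" "a' \<in> carr A" "b' \<in> carr A"
  shows "mul (tensor_alg A A) (pure A A a b) (pure A A a' b') = pure A A (mul A a a') (mul A b b')"
  unfolding tensor_alg_mul
  by (rule double_tlift(2)[OF vspace vspace vspace vspace is_vspace_tensor multilin4_tensor_mul assms])

text \<open>
  Both sides of every axiom are additive in each argument, which reduces them to pure tensors.
\<close>

lemma k_algebra_tensor_alg: "k_algebra (tensor_alg A A)"
proof
  let ?T = "tensor A A" let ?m = "mul (tensor_alg A A)"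
  show "is_vspace (tensor_alg A A)"
    using is_vspace_tensor[of A A] by (simp add: is_vspace_def tensor_alg_simps)
  note mb = tensor_alg_mul_bilin
  show "bilin_map (tensor_alg A A) (tensor_alg A A) (tensor_alg A A) ?m"
    using mb by (simp add: bilin_map_def lin_map_def tensor_alg_simps)
  note l = lin_mapD(2)[OF bilin_mapD(2)[OF mb]] and r = lin_mapD(2)[OF bilin_mapD(1)[OF mb]]
  have cl: "?m s t \<in> carr ?T" if "s \<in> carr ?T" "t \<in> carr ?T" for s t
    using lin_mapD(1)[OF bilin_mapD(1)[OF mb]] that by blast
  show "?m (?m x y) z = ?m x (?m y z)"
    if "x \<in> carr (tensor_alg A A)" "y \<in> carr (tensor_alg A A)" "z \<in> carr (tensor_alg A A)" for x y z
  proof -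
    have x: "x \<in> carr ?T" and y: "y \<in> carr ?T" and z: "z \<in> carr ?T"
      using that by (simp_all add: tensor_alg_simps)
    from vspace vspace x show ?thesis
    proof (induction x rule: tensor_induct)
      case (pure a b)
      note ab = this
      from vspace vspace y show ?case
      proof (induction y rule: tensor_induct)
        case (pure c d)
        note cd = this
        from vspace vspace z show ?case
        proof (induction z rule: tensor_induct)
          case (pure e f)
          then show ?case using ab cd by (simp add: tensor_alg_mul_pure mul_closed mul_assoc)
        next
          case (add s t)
          then show ?case using ab cd by (simp add: r cl pure_closed)
        qed
      next
        case (add s t)
        then show ?case using ab z by (simp add: l r cl pure_closed)
      qed
    next
      case (add s t)
      then show ?case using y z by (simp add: l cl)
    qed
  qed
  show 1: "munit (tensor_alg A A) \<in> carr (tensor_alg A A)"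
    by (simp add: tensor_alg_simps pure_closed munit_closed)
  show "?m (munit (tensor_alg A A)) x = x" if "x \<in> carr (tensor_alg A A)" for x
  proof -
    have x: "x \<in> carr ?T" using that by (simp add: tensor_alg_simps)
    from vspace vspace x show ?thesis
    proof (induction x rule: tensor_induct)
      case (pure a b)
      then show ?case by (simp add: tensor_alg_simps tensor_alg_mul_pure munit_closed munit_left)
    next
      case (add s t)
      then show ?case using 1 by (simp add: tensor_alg_simps r)
    qed
  qed
  show "?m x (munit (tensor_alg A A)) = x" if "x \<in> carr (tensor_alg A A)" for x
  proof -
    have x: "x \<in> carr ?T" using that by (simp add: tensor_alg_simps)
    from vspace vspace x show ?thesis
    proof (induction x rule: tensor_induct)
      case (pure a b)
      then show ?case by (simp add: tensor_alg_simps tensor_alg_mul_pure munit_closed munit_right)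
    next
      case (add s t)
      then show ?case using 1 by (simp add: tensor_alg_simps l)
    qed
  qed
qed

lemma tensor_inv_eq:
  assumes R: "R \<in> carr (tensor A A)" and U: "U \<in> carr (tensor A A)"
    and RU: "mul (tensor_alg A A) R U = munit (tensor_alg A A)"
    and UR: "mul (tensor_alg A A) U R = munit (tensor_alg A A)"
  shows "tensor_inv A R = U"
  unfolding tensor_inv_def
proof (rule the_equality)
  interpret T: k_algebra "tensor_alg A A" by (rule k_algebra_tensor_alg)
  fix W assume W: "W \<in> carr (tensor A A) \<and> mul (tensor_alg A A) R W = munit (tensor_alg A A) \<and>
     mul (tensor_alg A A) W R = munit (tensor_alg A A)"
  then have "W = mul (tensor_alg A A) W (mul (tensor_alg A A) R U)"
    by (simp add: RU T.munit_right tensor_alg_simps(1))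
  also have "\<dots> = U"
    using W R U by (subst T.mul_assoc[symmetric]) (simp_all add: tensor_alg_simps(1) T.munit_left)
  finally show "W = U" .
qed (use assms in simp)

end

section \<open>Sweedler calculus\<close>

definition trilin_map where
  "trilin_map V W X U f \<longleftrightarrow>
     (\<forall>x\<in>carr X. bilin_map V W U (\<lambda>v w. f v w x)) \<and> (\<forall>v\<in>carr V. bilin_map W X U (f v))"

lemma trilin_mapI:
  assumes "\<And>w x. w \<in> carr W \<Longrightarrow> x \<in> carr X \<Longrightarrow> lin_map V U (\<lambda>v. f v w x)"
    and "\<And>v x. v \<in> carr V \<Longrightarrow> x \<in> carr X \<Longrightarrow> lin_map W U (\<lambda>w. f v w x)"
    and "\<And>v w. v \<in> carr V \<Longrightarrow> w \<in> carr W \<Longrightarrow> lin_map X U (\<lambda>x. f v w x)"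
  shows "trilin_map V W X U f"
  using assms by (simp add: trilin_map_def bilin_map_def)

lemma tlift_push:
  assumes V: "is_vspace V" and W: "is_vspace W" and V': "is_vspace V'" and W': "is_vspace W'"
    and U: "is_vspace U"
    and f: "lin_map V V' f" and g: "lin_map W W' g" and B: "bilin_map V' W' U B"
    and t: "t \<in> carr (tensor V W)"
  shows "tlift V' W' B (tlift V W (\<lambda>x y. pure V' W' (f x) (g y)) t) = tlift V W (\<lambda>x y. B (f x) (g y)) t"
proof -
  have "tlift V' W' B (tlift V W (\<lambda>x y. pure V' W' (f x) (g y)) t) =
      tlift V W (\<lambda>x y. tlift V' W' B (pure V' W' (f x) (g y))) t"
    by (rule lin_map_apply_tlift[OF lin_map_tlift[OF V' W' U B] is_vspace_tensor V t])
      (intro pure_closed lin_mapD(1)[OF f] lin_mapD(1)[OF g])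
  also have "\<dots> = tlift V W (\<lambda>x y. B (f x) (g y)) t"
    by (rule tlift_cong[OF V t])
      (intro tlift_pure[OF V' W' U B] lin_mapD(1)[OF f] lin_mapD(1)[OF g])
  finally show ?thesis .
qed

context hopf_algebra
begin

lemma comul_closed: "h \<in> carr H \<Longrightarrow> comul H h \<in> carr (tensor H H)"
  by (rule lin_mapD(1)[OF comul_lin])

lemma lin_map_sweedler:
  assumes "is_vspace U" "bilin_map H H U f"
  shows "lin_map H U (\<lambda>h. tlift H H f (comul H h))"
  by (rule lin_map_compose[OF comul_lin lin_map_tlift[OF vspace vspace assms]])

text \<open>
  The axiom \<open>coassoc\<close> is an equation in \<open>H \<otimes> (H \<otimes> H)\<close>.  Applying to both sides the linear map
  induced by a trilinear \<open>f\<close> gives the form in which coassociativity is used in computations: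
  \<open>\<Sum> f h\<^sub>(\<^sub>1\<^sub>)\<^sub>(\<^sub>1\<^sub>) h\<^sub>(\<^sub>1\<^sub>)\<^sub>(\<^sub>2\<^sub>) h\<^sub>(\<^sub>2\<^sub>) = \<Sum> f h\<^sub>(\<^sub>1\<^sub>) h\<^sub>(\<^sub>2\<^sub>)\<^sub>(\<^sub>1\<^sub>) h\<^sub>(\<^sub>2\<^sub>)\<^sub>(\<^sub>2\<^sub>)\<close>.
  The lemmas after it do the same for the other axioms of the comultiplication.
\<close>

lemma sweedler_assoc:
  assumes U: "is_vspace U" and f: "trilin_map H H H U f" and h: "h \<in> carr H"
  shows "tlift H H (\<lambda>x z. tlift H H (\<lambda>x1 x2. f x1 x2 z) (comul H x)) (comul H h) =
    tlift H H (\<lambda>x z. tlift H H (\<lambda>z1 z2. f x z1 z2) (comul H z)) (comul H h)"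
proof -
  let ?F = "tlift H (tensor H H) (\<lambda>x. tlift H H (f x))"
  note T = is_vspace_tensor[of H H] is_vspace_tensor[of H "tensor H H"]
  have f1: "bilin_map H H U (f x)" and f2: "bilin_map H H U (\<lambda>v w. f v w x)" if "x \<in> carr H" for x
    using f that by (simp_all add: trilin_map_def)
  have B: "bilin_map H (tensor H H) U (\<lambda>x. tlift H H (f x))"
  proof (rule bilin_mapI)
    show "lin_map (tensor H H) U (tlift H H (f x))" if "x \<in> carr H" for x
      by (rule lin_map_tlift[OF vspace vspace U f1[OF that]])
    show "lin_map H U (\<lambda>x. tlift H H (f x) t)" if "t \<in> carr (tensor H H)" for t
    proof (rule lin_map_tlift_param[OF vspace U that])
      fix v w assume v: "v \<in> carr H" and w: "w \<in> carr H"
      show "lin_map H U (\<lambda>x. f x v w)" by (rule bilin_mapD(2)[OF f2[OF w] v])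
    qed
  qed
  note F = lin_map_tlift[OF vspace T(1) U B]
  have Fp: "?F (pure H (tensor H H) x t) = tlift H H (f x) t"
    if "x \<in> carr H" "t \<in> carr (tensor H H)" for x t
    by (rule tlift_pure[OF vspace T(1) U B that])
  have "?F (tlift H H (\<lambda>x z. tlift H H (\<lambda>x1 x2. pure H (tensor H H) x1 (pure H H x2 z)) (comul H x)) (comul H h))
    = tlift H H (\<lambda>x z. ?F (tlift H H (\<lambda>x1 x2. pure H (tensor H H) x1 (pure H H x2 z)) (comul H x))) (comul H h)"
    by (rule lin_map_apply_tlift[OF F T(2) vspace comul_closed[OF h]],
        rule tlift_closed[OF vspace T(2) comul_closed], assumption, intro pure_closed)
  also have "\<dots> = tlift H H (\<lambda>x z. tlift H H (\<lambda>x1 x2. ?F (pure H (tensor H H) x1 (pure H H x2 z))) (comul H x)) (comul H h)"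
    by (rule tlift_cong[OF vspace comul_closed[OF h]],
        rule lin_map_apply_tlift[OF F T(2) vspace comul_closed], assumption, intro pure_closed)
  also have "\<dots> = tlift H H (\<lambda>x z. tlift H H (\<lambda>x1 x2. f x1 x2 z) (comul H x)) (comul H h)"
    by (rule tlift_cong[OF vspace comul_closed[OF h]], rule tlift_cong[OF vspace comul_closed])
      (simp_all add: Fp pure_closed tlift_pure[OF vspace vspace U f1])
  finally have L: "?F (tlift H H (\<lambda>x z. tlift H H (\<lambda>x1 x2. pure H (tensor H H) x1 (pure H H x2 z)) (comul H x)) (comul H h))
    = tlift H H (\<lambda>x z. tlift H H (\<lambda>x1 x2. f x1 x2 z) (comul H x)) (comul H h)" .
  have "?F (tlift H H (\<lambda>x z. pure H (tensor H H) x (comul H z)) (comul H h))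
    = tlift H H (\<lambda>x z. ?F (pure H (tensor H H) x (comul H z))) (comul H h)"
    by (rule lin_map_apply_tlift[OF F T(2) vspace comul_closed[OF h]])
      (intro pure_closed comul_closed)
  also have "\<dots> = tlift H H (\<lambda>x z. tlift H H (f x) (comul H z)) (comul H h)"
    by (rule tlift_cong[OF vspace comul_closed[OF h]]) (simp add: Fp comul_closed)
  finally show ?thesis using L coassoc[OF h] by simp
qed

lemma sweedler_mul:
  assumes U: "is_vspace U" and f: "bilin_map H H U f" and g: "g \<in> carr H" and h: "h \<in> carr H"
  shows "tlift H H f (comul H (mul H g h)) =
    tlift H H (\<lambda>x y. tlift H H (\<lambda>u v. f (mul H x u) (mul H y v)) (comul H h)) (comul H g)"
proof -
  note F = lin_map_tlift[OF vspace vspace U f]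
  let ?D = "comul H"
  have "tlift H H f (?D (mul H g h)) =
    tlift H H f (tlift H H (\<lambda>x y. tlift H H (\<lambda>u v. pure H H (mul H x u) (mul H y v)) (?D h)) (?D g))"
    by (simp add: comul_mul g h tensor_alg_mul)
  also have "\<dots> = tlift H H (\<lambda>x y. tlift H H f (tlift H H (\<lambda>u v. pure H H (mul H x u) (mul H y v)) (?D h))) (?D g)"
    by (rule lin_map_apply_tlift[OF F is_vspace_tensor vspace comul_closed[OF g]],
      rule tlift_closed[OF vspace is_vspace_tensor comul_closed[OF h]], intro pure_closed mul_closed)
  also have "\<dots> = tlift H H (\<lambda>x y. tlift H H (\<lambda>u v. tlift H H f (pure H H (mul H x u) (mul H y v))) (?D h)) (?D g)"
    by (rule tlift_cong[OF vspace comul_closed[OF g]],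
      rule lin_map_apply_tlift[OF F is_vspace_tensor vspace comul_closed[OF h]],
      intro pure_closed mul_closed)
  also have "\<dots> = tlift H H (\<lambda>x y. tlift H H (\<lambda>u v. f (mul H x u) (mul H y v)) (?D h)) (?D g)"
    by (rule tlift_cong[OF vspace comul_closed[OF g]], rule tlift_cong[OF vspace comul_closed[OF h]],
      rule tlift_pure[OF vspace vspace U f]) (simp_all add: mul_closed)
  finally show ?thesis .
qed

lemma sweedler_munit:
  assumes "is_vspace U" "bilin_map H H U f"
  shows "tlift H H f (comul H (munit H)) = f (munit H) (munit H)"
  by (simp add: comul_munit tensor_alg_simps tlift_pure[OF vspace vspace assms] munit_closed)

lemma sweedler_counit_left:
  assumes U: "is_vspace U" and f: "lin_map H U f" and h: "h \<in> carr H"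
  shows "tlift H H (\<lambda>x y. smul U (counit H x) (f y)) (comul H h) = f h"
proof -
  have "f h = f (tlift H H (\<lambda>x y. smul H (counit H x) y) (comul H h))"
    by (simp add: counit_left h)
  also have "\<dots> = tlift H H (\<lambda>x y. f (smul H (counit H x) y)) (comul H h)"
    by (rule lin_map_apply_tlift[OF f vspace vspace comul_closed[OF h]]) (rule vspace_closed(3)[OF vspace])
  also have "\<dots> = tlift H H (\<lambda>x y. smul U (counit H x) (f y)) (comul H h)"
    by (rule tlift_cong[OF vspace comul_closed[OF h]]) (rule lin_mapD(3)[OF f])
  finally show ?thesis ..
qed

lemma sweedler_counit_right:
  assumes U: "is_vspace U" and f: "lin_map H U f" and h: "h \<in> carr H"
  shows "tlift H H (\<lambda>x y. smul U (counit H y) (f x)) (comul H h) = f h"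
proof -
  have "f h = f (tlift H H (\<lambda>x y. smul H (counit H y) x) (comul H h))"
    by (simp add: counit_right h)
  also have "\<dots> = tlift H H (\<lambda>x y. f (smul H (counit H y) x)) (comul H h)"
    by (rule lin_map_apply_tlift[OF f vspace vspace comul_closed[OF h]]) (rule vspace_closed(3)[OF vspace])
  also have "\<dots> = tlift H H (\<lambda>x y. smul U (counit H y) (f x)) (comul H h)"
    by (rule tlift_cong[OF vspace comul_closed[OF h]]) (rule lin_mapD(3)[OF f])
  finally show ?thesis ..
qed

end

section \<open>Transport of a Hopf algebra structure\<close>

lemma bilin_map_smul:
  assumes V: "is_vspace V" and W: "is_vspace W" and e: "lin_map V base_field e"
  shows "bilin_map V W W (\<lambda>x y. smul W (e x) y)" "bilin_map W V W (\<lambda>y x. smul W (e x) y)"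
  by (intro bilin_mapI lin_mapI; simp add: lin_mapD[OF e] vspace_closed[OF W]
      smul_simps[OF is_vspaceD(1)[OF W]] mult.commute)+

lemma lin_map_pure_left:
  "lin_map X V f \<Longrightarrow> y \<in> carr W \<Longrightarrow> lin_map X (tensor V W) (\<lambda>x. pure V W (f x) y)"
  by (rule lin_map_compose[OF _ bilin_mapD(2)[OF bilin_map_pure]])

lemma lin_map_pure_right:
  "lin_map X W f \<Longrightarrow> v \<in> carr V \<Longrightarrow> lin_map X (tensor V W) (\<lambda>x. pure V W v (f x))"
  by (rule lin_map_compose[OF _ bilin_mapD(1)[OF bilin_map_pure]])

text \<open>
  A map that satisfies \<open>hopf_iso\<close> already forces its target to be a Hopf algebra, as every axiom of the
  target is the image of the axiom of the source.  For this reason the axioms never have to be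
  verified in \<open>P(A,R)\<close> by means of the pentagon equation.  The axioms about \<open>\<Delta>\<close> are transported with
  the fact \<open>push\<close> below: a Sweedler sum over \<open>f x\<close> is the Sweedler sum over \<open>x\<close> of the images.
\<close>

lemma hopf_algebra_transport:
  fixes H :: "('k::field, 'a::ab_group_add, 'm) hopf_scheme"
    and K :: "('k, 'b::ab_group_add, 'n) hopf_scheme"
  assumes H: "hopf_algebra H" and iso: "hopf_iso H K f" and K: "vector_space (smul K)"
  shows "hopf_algebra K"
proof -
  interpret H: hopf_algebra H by (rule H)
  note vH = H.vspace
  have fl: "lin_map H K f" and bij: "bij_betw f (carr H) (carr K)"
    and fm: "\<And>x y. x \<in> carr H \<Longrightarrow> y \<in> carr H \<Longrightarrow> mul K (f x) (f y) = f (mul H x y)"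
    and fu: "munit K = f (munit H)"
    and fD: "\<And>x. x \<in> carr H \<Longrightarrow> comul K (f x) = tlift H H (\<lambda>u v. pure K K (f u) (f v)) (comul H x)"
    and fe: "\<And>x. x \<in> carr H \<Longrightarrow> counit K (f x) = counit H x"
    and fS: "\<And>x. x \<in> carr H \<Longrightarrow> antipode K (f x) = f (antipode H x)"
    using iso by (simp_all add: hopf_iso_def)
  have carrK: "carr K = f ` carr H"
    using bij by (simp add: bij_betw_def)
  have fa: "f x + f y = f (x + y)" if "x \<in> carr H" "y \<in> carr H" for x y
    using lin_mapD(2)[OF fl that] ..
  have fs: "smul K c (f x) = f (smul H c x)" if "x \<in> carr H" for c x
    using lin_mapD(3)[OF fl that] ..
  note cl = vspace_closed(1-3)[OF vH]
  have vK: "is_vspace K"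
    unfolding is_vspace_def module.subspace_def[OF K[folded module_iff_vector_space]]
    using lin_map_zero[OF fl vH] by (auto simp: K carrK fa fs cl intro: rev_image_eqI)
  have Kalg: "k_algebra K"
  proof
    show "is_vspace K" by (rule vK)
    show "bilin_map K K K (mul K)"
      by (intro bilin_mapI lin_mapI)
        (auto simp: carrK fm fa fs cl H.mul_linear H.mul_closed)
    show "munit K \<in> carr K" by (simp add: carrK fu H.munit_closed)
  qed (auto simp: carrK fm fu H.mul_assoc H.mul_closed H.munit_closed H.munit_left H.munit_right)
  interpret K: k_algebra K by (rule Kalg)
  have ff: "bilin_map H H (tensor K K) (\<lambda>u v. pure K K (f u) (f v))"
    by (rule bilin_map_pre[OF bilin_map_pure fl fl])
  have Dlin: "lin_map K (tensor K K) (comul K)"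
  proof -
    have "lin_map H (tensor K K) (\<lambda>x. comul K (f x))"
      using H.lin_map_sweedler[OF is_vspace_tensor ff] by (simp add: lin_map_def fD cl)
    from lin_mapD[OF this] show ?thesis
      by (intro lin_mapI) (auto simp: carrK fa fs)
  qed
  have elin: "lin_map K base_field (counit K)"
    using lin_mapD[OF H.counit_lin] by (intro lin_mapI) (auto simp: carrK fa fs fe cl)
  have Slin: "lin_map K K (antipode K)"
    using lin_mapD[OF H.antipode_lin] by (intro lin_mapI) (auto simp: carrK fa fs fS cl)
  have push: "tlift K K B (comul K (f x)) = tlift H H (\<lambda>u v. B (f u) (f v)) (comul H x)"
    if "is_vspace U" "bilin_map K K U B" "x \<in> carr H" for U :: "('k, 'c::ab_group_add, 'p) vspace_scheme" and B x
    unfolding fD[OF that(3)] by (rule tlift_push[OF vH vH vK vK that(1) fl fl that(2) H.comul_closed[OF that(3)]])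
  note fc = lin_mapD(1)[OF fl]
  let ?T = "tensor K (tensor K K)"
  note T = is_vspace_tensor[of K "tensor K K"]
  show ?thesis
  proof (intro hopf_algebra.intro[OF Kalg] hopf_algebra_axioms.intro)
    show "lin_map K (tensor K K) (comul K)" by (rule Dlin)
    show "lin_map K base_field (counit K)" by (rule elin)
    show "lin_map K K (antipode K)" by (rule Slin)
    show "counit K (munit K) = 1" by (simp add: fu fe H.munit_closed H.counit_munit)
    show "counit K (mul K g h) = counit K g * counit K h" if "g \<in> carr K" "h \<in> carr K" for g h
      using that by (auto simp: carrK fm fe H.mul_closed H.counit_mul)
    show "comul K (munit K) = munit (tensor_alg K K)"
      by (simp add: fu fD H.munit_closed H.sweedler_munit[OF is_vspace_tensor ff] K.tensor_alg_simps)
    fix h assume "h \<in> carr K"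
    then obtain a where a: "a \<in> carr H" "h = f a" by (auto simp: carrK)
    note Da = H.comul_closed[OF a(1)]
    show "tlift K K (\<lambda>x y. smul K (counit K x) y) (comul K h) = h"
    proof -
      have "tlift K K (\<lambda>x y. smul K (counit K x) y) (comul K h)
          = tlift H H (\<lambda>x y. smul K (counit K (f x)) (f y)) (comul H a)"
        unfolding a(2) by (rule push[OF vK bilin_map_smul(1)[OF vK vK elin] a(1)])
      also have "\<dots> = tlift H H (\<lambda>x y. smul K (counit H x) (f y)) (comul H a)"
        by (rule tlift_cong[OF vH Da]) (simp add: fe)
      finally show ?thesis by (simp add: H.sweedler_counit_left[OF vK fl] a)
    qed
    show "tlift K K (\<lambda>x y. smul K (counit K y) x) (comul K h) = h"
    proof -
      have "tlift K K (\<lambda>x y. smul K (counit K y) x) (comul K h)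
          = tlift H H (\<lambda>x y. smul K (counit K (f y)) (f x)) (comul H a)"
        unfolding a(2) by (rule push[OF vK bilin_map_smul(2)[OF vK vK elin] a(1)])
      also have "\<dots> = tlift H H (\<lambda>x y. smul K (counit H y) (f x)) (comul H a)"
        by (rule tlift_cong[OF vH Da]) (simp add: fe)
      finally show ?thesis by (simp add: H.sweedler_counit_right[OF vK fl] a)
    qed
    show "tlift K K (\<lambda>x y. mul K (antipode K x) y) (comul K h) = smul K (counit K h) (munit K)"
    proof -
      have "tlift K K (\<lambda>x y. mul K (antipode K x) y) (comul K h)
          = tlift H H (\<lambda>x y. mul K (antipode K (f x)) (f y)) (comul H a)"
        unfolding a(2) by (rule push[OF vK bilin_map_pre[OF K.mul_bilin Slin lin_map_id] a(1)])
      also have "\<dots> = tlift H H (\<lambda>x y. f (mul H (antipode H x) y)) (comul H a)"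
        by (rule tlift_cong[OF vH Da]) (simp add: fS fm lin_mapD(1)[OF H.antipode_lin])
      also have "\<dots> = f (tlift H H (\<lambda>x y. mul H (antipode H x) y) (comul H a))"
        by (rule lin_map_apply_tlift[OF fl vH vH Da, symmetric])
          (intro H.mul_closed lin_mapD(1)[OF H.antipode_lin])
      finally show ?thesis by (simp add: H.antipode_left a fe fu fs H.munit_closed)
    qed
    show "tlift K K (\<lambda>x y. mul K x (antipode K y)) (comul K h) = smul K (counit K h) (munit K)"
    proof -
      have "tlift K K (\<lambda>x y. mul K x (antipode K y)) (comul K h)
          = tlift H H (\<lambda>x y. mul K (f x) (antipode K (f y))) (comul H a)"
        unfolding a(2) by (rule push[OF vK bilin_map_pre[OF K.mul_bilin lin_map_id Slin] a(1)])
      also have "\<dots> = tlift H H (\<lambda>x y. f (mul H x (antipode H y))) (comul H a)"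
        by (rule tlift_cong[OF vH Da]) (simp add: fS fm lin_mapD(1)[OF H.antipode_lin])
      also have "\<dots> = f (tlift H H (\<lambda>x y. mul H x (antipode H y)) (comul H a))"
        by (rule lin_map_apply_tlift[OF fl vH vH Da, symmetric])
          (intro H.mul_closed lin_mapD(1)[OF H.antipode_lin])
      finally show ?thesis by (simp add: H.antipode_right a fe fu fs H.munit_closed)
    qed
    show "tlift K K (\<lambda>x z. tlift K K (\<lambda>x1 x2. pure K (tensor K K) x1 (pure K K x2 z)) (comul K x)) (comul K h)
      = tlift K K (\<lambda>x z. pure K (tensor K K) x (comul K z)) (comul K h)"
    proof -
      let ?p = "\<lambda>x1 x2 z. pure K (tensor K K) x1 (pure K K x2 z)"
      have p12: "bilin_map K K ?T (\<lambda>x1 x2. ?p x1 x2 z)" if "z \<in> carr K" for z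
        by (intro bilin_mapI lin_map_pure_left lin_map_pure_right lin_map_id pure_closed that)
      have p23: "bilin_map K K ?T (?p x)" if "x \<in> carr K" for x
        by (intro bilin_mapI lin_map_pure_left lin_map_pure_right lin_map_id pure_closed that)
      have b: "bilin_map K K ?T (\<lambda>x z. tlift K K (\<lambda>x1 x2. ?p x1 x2 z) (comul K x))"
      proof (rule bilin_mapI)
        show "lin_map K ?T (\<lambda>z. tlift K K (\<lambda>x1 x2. ?p x1 x2 z) (comul K x))" if "x \<in> carr K" for x
          by (rule lin_map_tlift_param[OF vK T lin_mapD(1)[OF Dlin that]])
            (intro lin_map_pure_right lin_map_id)
        show "lin_map K ?T (\<lambda>x. tlift K K (\<lambda>x1 x2. ?p x1 x2 z) (comul K x))" if "z \<in> carr K" for z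
          by (rule lin_map_compose[OF Dlin lin_map_tlift[OF vK vK T p12[OF that]]])
      qed
      have "tlift K K (\<lambda>x z. tlift K K (\<lambda>x1 x2. ?p x1 x2 z) (comul K x)) (comul K h)
        = tlift H H (\<lambda>x z. tlift K K (\<lambda>x1 x2. ?p x1 x2 (f z)) (comul K (f x))) (comul H a)"
        unfolding a(2) by (rule push[OF T b a(1)])
      also have "\<dots> = tlift H H (\<lambda>x z. tlift H H (\<lambda>x1 x2. ?p (f x1) (f x2) (f z)) (comul H x)) (comul H a)"
        by (rule tlift_cong[OF vH Da], rule push[OF T p12[OF fc]])
      also have "\<dots> = tlift H H (\<lambda>x z. tlift H H (\<lambda>z1 z2. ?p (f x) (f z1) (f z2)) (comul H z)) (comul H a)"
        by (rule H.sweedler_assoc[OF T _ a(1)])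
          (intro trilin_mapI lin_map_pure_left lin_map_pure_right fl pure_closed fc)
      also have "\<dots> = tlift H H (\<lambda>x z. pure K (tensor K K) (f x) (comul K (f z))) (comul H a)"
      proof (rule tlift_cong[OF vH Da])
        fix x z assume x: "x \<in> carr H" and z: "z \<in> carr H"
        show "tlift H H (\<lambda>z1 z2. ?p (f x) (f z1) (f z2)) (comul H z) = pure K (tensor K K) (f x) (comul K (f z))"
          unfolding fD[OF z]
          by (rule lin_map_apply_tlift[OF bilin_mapD(1)[OF bilin_map_pure fc[OF x]]
                is_vspace_tensor vH H.comul_closed[OF z], symmetric]) (intro pure_closed fc)
      qed
      also have "\<dots> = tlift K K (\<lambda>x z. pure K (tensor K K) x (comul K z)) (comul K h)"
        unfolding a(2)
        by (rule push[OF T bilin_map_pre[OF bilin_map_pure lin_map_id Dlin] a(1), symmetric])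
      finally show ?thesis .
    qed
    fix g assume "g \<in> carr K"
    then obtain b where b: "b \<in> carr H" "g = f b" by (auto simp: carrK)
    note Db = H.comul_closed[OF b(1)]
    show "comul K (mul K g h) = mul (tensor_alg K K) (comul K g) (comul K h)"
    proof -
      let ?q = "\<lambda>x y u v. pure K K (mul K x u) (mul K y v)"
      have "comul K (mul K g h) = tlift H H (\<lambda>u v. pure K K (f u) (f v)) (comul H (mul H b a))"
        by (simp add: a b fm fD H.mul_closed)
      also have "\<dots> = tlift H H (\<lambda>x y. tlift H H (\<lambda>u v. pure K K (f (mul H x u)) (f (mul H y v))) (comul H a)) (comul H b)"
        by (rule H.sweedler_mul[OF is_vspace_tensor ff b(1) a(1)])
      also have "\<dots> = tlift H H (\<lambda>x y. tlift H H (\<lambda>u v. ?q (f x) (f y) (f u) (f v)) (comul H a)) (comul H b)"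
        by (rule tlift_cong[OF vH Db], rule tlift_cong[OF vH Da]) (simp add: fm)
      also have "\<dots> = tlift H H (\<lambda>x y. tlift K K (?q (f x) (f y)) (comul K h)) (comul H b)"
        unfolding a(2)
        by (rule tlift_cong[OF vH Db], rule push[OF is_vspace_tensor _ a(1), symmetric],
            rule bilin_map_pre[OF bilin_map_pure K.mul_lin_right K.mul_lin_right]) (rule fc, assumption)+
      also have "\<dots> = tlift K K (\<lambda>x y. tlift K K (?q x y) (comul K h)) (comul K g)"
        unfolding b(2)
      proof (rule push[OF is_vspace_tensor _ b(1), symmetric], rule bilin_mapI)
        have Dh: "comul K h \<in> carr (tensor K K)" by (rule lin_mapD(1)[OF Dlin \<open>h \<in> carr K\<close>])
        show "lin_map K (tensor K K) (\<lambda>y. tlift K K (?q x y) (comul K h))" if "x \<in> carr K" for x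
          by (rule lin_map_tlift_param[OF vK is_vspace_tensor Dh])
            (intro lin_map_pure_right K.mul_lin_left K.mul_closed that)
        show "lin_map K (tensor K K) (\<lambda>x. tlift K K (?q x y) (comul K h))" if "y \<in> carr K" for y
          by (rule lin_map_tlift_param[OF vK is_vspace_tensor Dh])
            (intro lin_map_pure_left K.mul_lin_left K.mul_closed that)
      qed
      finally show ?thesis by (simp add: K.tensor_alg_mul)
    qed
  qed
qed

section \<open>The dual of a Hopf algebra as a module algebra\<close>

lemma is_vspace_dual:
  assumes "is_vspace V"
  shows "is_vspace (dual V)"
proof -
  note c = vspace_closed(1-3)[OF assms]
  show ?thesis
    unfolding is_vspace_def dual_def module.subspace_def[OF module_fun_smul] vspace.simps
    by (simp add: vector_space_fun_smul lin_map_def fun_arith fun_smul_def algebra_simps)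
qed

lemma dual_simps [simp]: "smul (dual V) = fun_smul"
  by (simp add: dual_def)

lemma dualD:
  assumes "\<phi> \<in> carr (dual V)"
  shows "lin_map V base_field \<phi>" "x \<notin> carr V \<Longrightarrow> \<phi> x = 0"
  using assms by (simp_all add: dual_def)

lemma on_carr_dual:
  assumes "is_vspace V" "lin_map V base_field f"
  shows "on_carr V f \<in> carr (dual V)"
  using assms(2) vspace_closed(2,3)[OF assms(1)]
  by (simp add: dual_def on_carr_def lin_map_def)

lemma dual_eqI:
  assumes "\<phi> \<in> carr (dual V)" "\<psi> \<in> carr (dual V)" "\<And>x. x \<in> carr V \<Longrightarrow> \<phi> x = \<psi> x"
  shows "\<phi> = \<psi>"
proof
  show "\<phi> x = \<psi> x" for x
    using assms dualD(2)[OF assms(1)] dualD(2)[OF assms(2)] by (cases "x \<in> carr V") simp_all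
qed

lemma lin_map_eval: "lin_map (dual V) base_field (\<lambda>\<phi>. \<phi> x)"
  by (rule lin_mapI) (simp_all add: fun_arith fun_smul_def)

lemma tlift_scale:
  fixes c :: "'k::field"
  shows "tlift V W (\<lambda>x y. c * f x y) t = c * tlift V W f t"
    and "tlift V W (\<lambda>x y. f x y * c) t = tlift V W f t * c"
  by (simp_all add: tlift_rep case_prod_unfold sum_list_const_mult sum_list_mult_const)

context hopf_algebra
begin

abbreviation dualH ("H\<^sup>*") where "dualH \<equiv> dual H"

text \<open>
  \<open>sw f h\<close> is the Sweedler sum \<open>\<Sum> f h\<^sub>(\<^sub>1\<^sub>) h\<^sub>(\<^sub>2\<^sub>)\<close>.
\<close>

abbreviation sw where "sw f h \<equiv> tlift H H f (comul H h)"

lemmas vdual = is_vspace_dual[OF vspace]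

lemma bilin_conv:
  assumes "\<phi> \<in> carr H\<^sup>*" "\<psi> \<in> carr H\<^sup>*"
  shows "bilin_map H H base_field (\<lambda>x y. \<phi> x * \<psi> y)"
  using lin_mapD[OF dualD(1)[OF assms(1)]] lin_mapD[OF dualD(1)[OF assms(2)]]
  by (intro bilin_mapI lin_mapI) (simp_all add: algebra_simps)

lemma conv_apply: "h \<in> carr H \<Longrightarrow> conv H \<phi> \<psi> h = sw (\<lambda>x y. \<phi> x * \<psi> y) h"
  by (simp add: conv_def on_carr_def)

lemma act_apply: "h' \<in> carr H \<Longrightarrow> dual_act H h \<psi> h' = \<psi> (mul H h' h)"
  by (simp add: dual_act_def on_carr_def)

lemma conv_closed:
  assumes "\<phi> \<in> carr H\<^sup>*" "\<psi> \<in> carr H\<^sup>*"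
  shows "conv H \<phi> \<psi> \<in> carr H\<^sup>*"
  unfolding conv_def
  by (rule on_carr_dual[OF vspace lin_map_sweedler[OF is_vspace_base_field bilin_conv[OF assms]]])

lemma act_closed:
  assumes "h \<in> carr H" "\<psi> \<in> carr H\<^sup>*"
  shows "dual_act H h \<psi> \<in> carr H\<^sup>*"
  unfolding dual_act_def
  by (rule on_carr_dual[OF vspace lin_map_compose[OF mul_lin_left[OF assms(1)] dualD(1)[OF assms(2)]]])

lemma conv_lin:
  assumes "\<psi> \<in> carr H\<^sup>*"
  shows "lin_map H\<^sup>* H\<^sup>* (\<lambda>\<phi>. conv H \<phi> \<psi>)" "lin_map H\<^sup>* H\<^sup>* (conv H \<psi>)"
proof -
  note d = conv_def on_carr_def fun_eq_iff fun_arith fun_smul_def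
  show "lin_map H\<^sup>* H\<^sup>* (\<lambda>\<phi>. conv H \<phi> \<psi>)"
    by (intro lin_mapI conv_closed assms;
        simp add: d distrib_right tlift_add mult.assoc tlift_scale)
  have c: "\<psi> x * (c * \<phi> y) = c * (\<psi> x * \<phi> y)" for c \<phi> x y
    by simp
  show "lin_map H\<^sup>* H\<^sup>* (conv H \<psi>)"
    by (intro lin_mapI conv_closed assms;
        simp add: d distrib_left tlift_add c tlift_scale)
qed

lemma act_lin:
  shows "h \<in> carr H \<Longrightarrow> lin_map H\<^sup>* H\<^sup>* (dual_act H h)"
    and "\<psi> \<in> carr H\<^sup>* \<Longrightarrow> lin_map H H\<^sup>* (\<lambda>h. dual_act H h \<psi>)"
proof -
  show "lin_map H\<^sup>* H\<^sup>* (dual_act H h)" if "h \<in> carr H"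
    by (intro lin_mapI act_closed that;
        simp add: dual_act_def on_carr_def fun_eq_iff fun_arith fun_smul_def)
  show "lin_map H H\<^sup>* (\<lambda>h. dual_act H h \<psi>)" if "\<psi> \<in> carr H\<^sup>*"
    using lin_mapD[OF dualD(1)[OF that]]
    by (intro lin_mapI act_closed that;
        simp add: that dual_act_def on_carr_def fun_eq_iff fun_arith fun_smul_def
        mul_linear mul_closed)
qed

abbreviation eps ("\<epsilon>") where "eps \<equiv> on_carr H (counit H)"

lemma eps_closed: "\<epsilon> \<in> carr H\<^sup>*"
  by (rule on_carr_dual[OF vspace counit_lin])

lemma eps_apply: "x \<in> carr H \<Longrightarrow> \<epsilon> x = counit H x"
  by (simp add: on_carr_def)

lemma act_unit: "\<psi> \<in> carr H\<^sup>* \<Longrightarrow> dual_act H (munit H) \<psi> = \<psi>"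
  by (rule dual_eqI[of _ H]) (simp_all add: act_closed munit_closed act_apply munit_right)

lemma act_eps: "h \<in> carr H \<Longrightarrow> dual_act H h \<epsilon> = fun_smul (counit H h) \<epsilon>"
  by (simp add: fun_eq_iff dual_act_def on_carr_def fun_smul_def mul_closed counit_mul mult.commute)

lemma act_mul:
  assumes "g \<in> carr H" "h \<in> carr H" "\<psi> \<in> carr H\<^sup>*"
  shows "dual_act H (mul H g h) \<psi> = dual_act H g (dual_act H h \<psi>)"
  by (rule dual_eqI[of _ H]) (simp_all add: assms act_closed mul_closed act_apply mul_assoc)

lemma conv_eps:
  assumes "\<psi> \<in> carr H\<^sup>*"
  shows "conv H \<epsilon> \<psi> = \<psi>" "conv H \<psi> \<epsilon> = \<psi>"
proof -
  note b = is_vspace_base_field and l = dualD(1)[OF assms]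
  show "conv H \<epsilon> \<psi> = \<psi>"
  proof (rule dual_eqI[of _ H])
    fix h assume h: "h \<in> carr H"
    have "sw (\<lambda>x y. \<epsilon> x * \<psi> y) h = sw (\<lambda>x y. counit H x * \<psi> y) h"
      by (rule tlift_cong[OF vspace comul_closed[OF h]]) (simp add: eps_apply)
    then show "conv H \<epsilon> \<psi> h = \<psi> h"
      using sweedler_counit_left[OF b l h] h by (simp add: conv_apply)
  qed (simp_all add: assms conv_closed eps_closed)
  show "conv H \<psi> \<epsilon> = \<psi>"
  proof (rule dual_eqI[of _ H])
    fix h assume h: "h \<in> carr H"
    have "sw (\<lambda>x y. \<psi> x * \<epsilon> y) h = sw (\<lambda>x y. counit H y * \<psi> x) h"
      by (rule tlift_cong[OF vspace comul_closed[OF h]]) (simp add: eps_apply mult.commute)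
    then show "conv H \<psi> \<epsilon> h = \<psi> h"
      using sweedler_counit_right[OF b l h] h by (simp add: conv_apply)
  qed (simp_all add: assms conv_closed eps_closed)
qed

lemma conv_assoc:
  assumes p: "\<phi> \<in> carr H\<^sup>*" and q: "\<psi> \<in> carr H\<^sup>*" and r: "\<chi> \<in> carr H\<^sup>*"
  shows "conv H (conv H \<phi> \<psi>) \<chi> = conv H \<phi> (conv H \<psi> \<chi>)"
proof (rule dual_eqI[of _ H])
  fix h assume h: "h \<in> carr H"
  note D = comul_closed[OF h]
  note lp = lin_mapD[OF dualD(1)[OF p]] and lq = lin_mapD[OF dualD(1)[OF q]]
    and lr = lin_mapD[OF dualD(1)[OF r]]
  have "conv H (conv H \<phi> \<psi>) \<chi> h = sw (\<lambda>x z. sw (\<lambda>x1 x2. \<phi> x1 * \<psi> x2 * \<chi> z) x) h"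
    unfolding conv_apply[OF h] by (rule tlift_cong[OF vspace D]) (simp add: conv_apply tlift_scale)
  also have "\<dots> = sw (\<lambda>x z. sw (\<lambda>z1 z2. \<phi> x * \<psi> z1 * \<chi> z2) z) h"
    by (rule sweedler_assoc[OF is_vspace_base_field _ h], intro trilin_mapI lin_mapI;
      simp add: lp lq lr algebra_simps)
  also have "\<dots> = conv H \<phi> (conv H \<psi> \<chi>) h"
    unfolding conv_apply[OF h]
    by (rule tlift_cong[OF vspace D]) (simp add: conv_apply mult.assoc tlift_scale)
  finally show "conv H (conv H \<phi> \<psi>) \<chi> h = conv H \<phi> (conv H \<psi> \<chi>) h" .
qed (simp_all add: assms conv_closed)

text \<open>
  \<open>H\<^sup>*\<close> is a module algebra over \<open>H\<close>, because \<open>\<Delta>\<close> is multiplicative: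
  \<open>(\<phi> \<psi>)(x h) = \<Sum> \<phi>(x\<^sub>(\<^sub>1\<^sub>) h\<^sub>(\<^sub>1\<^sub>)) \<psi>(x\<^sub>(\<^sub>2\<^sub>) h\<^sub>(\<^sub>2\<^sub>))\<close>.  This is the reason for which the smash product
  below is associative.
\<close>

lemma act_conv:
  assumes h: "h \<in> carr H" and p: "\<phi> \<in> carr H\<^sup>*" and q: "\<psi> \<in> carr H\<^sup>*"
  shows "dual_act H h (conv H \<phi> \<psi>) = sw (\<lambda>a b. conv H (dual_act H a \<phi>) (dual_act H b \<psi>)) h"
proof (rule dual_eqI[of _ H])
  note D = comul_closed[OF h]
  show "sw (\<lambda>a b. conv H (dual_act H a \<phi>) (dual_act H b \<psi>)) h \<in> carr H\<^sup>*"
    by (rule tlift_closed[OF vspace vdual D]) (intro conv_closed act_closed p q)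
  fix x assume x: "x \<in> carr H"
  have "dual_act H h (conv H \<phi> \<psi>) x = sw (\<lambda>u v. sw (\<lambda>a b. \<phi> (mul H u a) * \<psi> (mul H v b)) h) x"
    by (simp add: act_apply x conv_apply mul_closed h sweedler_mul[OF is_vspace_base_field bilin_conv[OF p q]])
  also have "\<dots> = sw (\<lambda>a b. sw (\<lambda>u v. \<phi> (mul H u a) * \<psi> (mul H v b)) x) h"
    by (rule tlift_swap)
  also have "\<dots> = sw (\<lambda>a b. sw (\<lambda>u v. dual_act H a \<phi> u * dual_act H b \<psi> v) x) h"
    by (rule tlift_cong[OF vspace D], rule tlift_cong[OF vspace comul_closed[OF x]]) (simp add: act_apply)
  finally show "dual_act H h (conv H \<phi> \<psi>) x
      = sw (\<lambda>a b. conv H (dual_act H a \<phi>) (dual_act H b \<psi>)) h x"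
    by (simp add: tlift_apply conv_apply x)
qed (simp_all add: assms conv_closed act_closed)

lemma lin_map_mul_left: "lin_map X H f \<Longrightarrow> y \<in> carr H \<Longrightarrow> lin_map X H (\<lambda>x. mul H (f x) y)"
  by (rule lin_map_compose[OF _ mul_lin_left])

lemma lin_map_mul_right: "lin_map X H f \<Longrightarrow> y \<in> carr H \<Longrightarrow> lin_map X H (\<lambda>x. mul H y (f x))"
  by (rule lin_map_compose[OF _ mul_lin_right])

lemma lin_map_conv_left:
  "lin_map X H\<^sup>* f \<Longrightarrow> \<psi> \<in> carr H\<^sup>* \<Longrightarrow> lin_map X H\<^sup>* (\<lambda>x. conv H (f x) \<psi>)"
  by (rule lin_map_compose[OF _ conv_lin(1)])

lemma lin_map_conv_right:
  "lin_map X H\<^sup>* f \<Longrightarrow> \<psi> \<in> carr H\<^sup>* \<Longrightarrow> lin_map X H\<^sup>* (\<lambda>x. conv H \<psi> (f x))"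
  by (rule lin_map_compose[OF _ conv_lin(2)])

lemma lin_map_act_left:
  "lin_map X H f \<Longrightarrow> \<psi> \<in> carr H\<^sup>* \<Longrightarrow> lin_map X H\<^sup>* (\<lambda>x. dual_act H (f x) \<psi>)"
  by (rule lin_map_compose[OF _ act_lin(2)])

lemma lin_map_act_right:
  "lin_map X H\<^sup>* f \<Longrightarrow> h \<in> carr H \<Longrightarrow> lin_map X H\<^sup>* (\<lambda>x. dual_act H h (f x))"
  by (rule lin_map_compose[OF _ act_lin(1)])

lemmas lin_intros = lin_map_id lin_map_pure_left lin_map_pure_right lin_map_mul_left lin_map_mul_right
  lin_map_conv_left lin_map_conv_right lin_map_act_left lin_map_act_right
  mul_closed conv_closed act_closed pure_closed

section \<open>The Heisenberg double is an algebra\<close>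

text \<open>
  The product \<open>(h # \<phi>)(g # \<psi>)\<close> of the Heisenberg double.
\<close>

definition smash where
  "smash h \<phi> g \<psi> = sw (\<lambda>h1 h2. pure H H\<^sup>* (mul H h2 g) (conv H \<phi> (dual_act H h1 \<psi>))) h"

abbreviation "HH \<equiv> tensor H H\<^sup>*"

lemma heisenberg_simps:
  "carr (heisenberg H) = carr HH" "smul (heisenberg H) = fun_smul"
  "munit (heisenberg H) = pure H H\<^sup>* (munit H) \<epsilon>"
  by (simp_all add: heisenberg_def)

lemma heisenberg_mul:
  "mul (heisenberg H) s t = tlift H H\<^sup>* (\<lambda>h \<phi>. tlift H H\<^sup>* (\<lambda>g \<psi>. smash h \<phi> g \<psi>) t) s"
  by (simp add: heisenberg_def smash_def)

lemma smash_multilin: "multilin4 H H\<^sup>* H H\<^sup>* HH smash"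
  unfolding multilin4_def smash_def
proof (intro conjI ballI bilin_mapI)
  note T = is_vspace_tensor[of H "H\<^sup>*"]
  let ?B = "\<lambda>\<phi> g \<psi> h1 h2. pure H H\<^sup>* (mul H h2 g) (conv H \<phi> (dual_act H h1 \<psi>))"
  show "lin_map H HH (\<lambda>h. sw (?B \<phi> g \<psi>) h)"
    if "\<phi> \<in> carr H\<^sup>*" "g \<in> carr H" "\<psi> \<in> carr H\<^sup>*" for \<phi> g \<psi>
    by (rule lin_map_sweedler[OF T]) (intro bilin_mapI lin_intros that)
  show "lin_map H\<^sup>* HH (\<lambda>\<phi>. sw (?B \<phi> g \<psi>) h)"
    if "h \<in> carr H" "g \<in> carr H" "\<psi> \<in> carr H\<^sup>*" for h g \<psi>
    by (rule lin_map_tlift_param[OF vspace T comul_closed[OF that(1)]]) (intro lin_intros that)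
  show "lin_map H HH (\<lambda>g. sw (?B \<phi> g \<psi>) h)"
    if "h \<in> carr H" "\<phi> \<in> carr H\<^sup>*" "\<psi> \<in> carr H\<^sup>*" for h \<phi> \<psi>
    by (rule lin_map_tlift_param[OF vspace T comul_closed[OF that(1)]]) (intro lin_intros that)
  show "lin_map H\<^sup>* HH (\<lambda>\<psi>. sw (?B \<phi> g \<psi>) h)"
    if "h \<in> carr H" "\<phi> \<in> carr H\<^sup>*" "g \<in> carr H" for h \<phi> g
    by (rule lin_map_tlift_param[OF vspace T comul_closed[OF that(1)]]) (intro lin_intros that)
qed

lemma heisenberg_mul_bilin: "bilin_map HH HH HH (mul (heisenberg H))"
  unfolding heisenberg_mul
  by (rule double_tlift(1)[OF vspace vdual vspace vdual is_vspace_tensor smash_multilin])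

lemma heisenberg_mul_pure:
  "\<lbrakk>h \<in> carr H; \<phi> \<in> carr H\<^sup>*; g \<in> carr H; \<psi> \<in> carr H\<^sup>*\<rbrakk> \<Longrightarrow>
    mul (heisenberg H) (pure H H\<^sup>* h \<phi>) (pure H H\<^sup>* g \<psi>) = smash h \<phi> g \<psi>"
  unfolding heisenberg_mul
  by (rule double_tlift(2)[OF vspace vdual vspace vdual is_vspace_tensor smash_multilin])

text \<open>
  Both sides equal
  \<open>\<Sum> h\<^sub>(\<^sub>3\<^sub>) g\<^sub>(\<^sub>2\<^sub>) k # \<phi> (h\<^sub>(\<^sub>1\<^sub>) \<cdot> \<psi>) (h\<^sub>(\<^sub>2\<^sub>) g\<^sub>(\<^sub>1\<^sub>) \<cdot> \<chi>)\<close>.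
  The left side yields it by multiplicativity of \<open>\<Delta>\<close>, the right side by \<open>act_conv\<close>; the two ways of
  forming the triple coproduct of \<open>h\<close> are matched by coassociativity.
\<close>

lemma heisenberg_assoc_pure:
  assumes h: "h \<in> carr H" and p: "\<phi> \<in> carr H\<^sup>*" and g: "g \<in> carr H" and q: "\<psi> \<in> carr H\<^sup>*"
    and k: "k \<in> carr H" and r: "\<chi> \<in> carr H\<^sup>*"
  shows "mul (heisenberg H) (smash h \<phi> g \<psi>) (pure H H\<^sup>* k \<chi>) =
    mul (heisenberg H) (pure H H\<^sup>* h \<phi>) (smash g \<psi> k \<chi>)"
proof -
  note T = is_vspace_tensor[of H "H\<^sup>*"]
  let ?m = "mul (heisenberg H)"
  note Dh = comul_closed[OF h] and Dg = comul_closed[OF g]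
  note ml = bilin_mapD(2)[OF heisenberg_mul_bilin] and mr = bilin_mapD(1)[OF heisenberg_mul_bilin]
  \<comment> \<open>The common value, as a function of the three tensor factors of the iterated coproduct of h.\<close>
  define f where "f x y z = sw (\<lambda>g1 g2. pure H H\<^sup>* (mul H (mul H z g2) k)
      (conv H (conv H \<phi> (dual_act H x \<psi>)) (dual_act H (mul H y g1) \<chi>))) g" for x y z
  have f: "trilin_map H H H HH f"
    unfolding f_def
    by (intro trilin_mapI; rule lin_map_tlift_param[OF vspace T Dg]; intro lin_intros assms; assumption)
  have "?m (smash h \<phi> g \<psi>) (pure H H\<^sup>* k \<chi>)
      = sw (\<lambda>h1 h2. ?m (pure H H\<^sup>* (mul H h2 g) (conv H \<phi> (dual_act H h1 \<psi>))) (pure H H\<^sup>* k \<chi>)) h"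
    unfolding smash_def
    by (rule lin_map_apply_tlift[OF ml[OF pure_closed[OF k r]] T vspace Dh]) (intro lin_intros assms)
  also have "\<dots> = sw (\<lambda>x z. sw (f x) z) h"
  proof (rule tlift_cong[OF vspace Dh])
    fix x z assume x: "x \<in> carr H" and z: "z \<in> carr H"
    let ?c = "conv H \<phi> (dual_act H x \<psi>)"
    have c: "?c \<in> carr H\<^sup>*" by (intro lin_intros x p q)
    have b: "bilin_map H H HH (\<lambda>u v. pure H H\<^sup>* (mul H v k) (conv H ?c (dual_act H u \<chi>)))"
      by (intro bilin_mapI lin_intros k r x p q; assumption)
    have "?m (pure H H\<^sup>* (mul H z g) ?c) (pure H H\<^sup>* k \<chi>) = smash (mul H z g) ?c k \<chi>"
      by (intro heisenberg_mul_pure mul_closed c z g k r)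
    also have "\<dots> = sw (\<lambda>a b. sw (\<lambda>g1 g2. pure H H\<^sup>* (mul H (mul H b g2) k)
        (conv H ?c (dual_act H (mul H a g1) \<chi>))) g) z"
      unfolding smash_def by (rule sweedler_mul[OF T b z g])
    also have "\<dots> = sw (f x) z"
      by (simp add: f_def[abs_def])
    finally show "?m (pure H H\<^sup>* (mul H z g) ?c) (pure H H\<^sup>* k \<chi>) = sw (f x) z" .
  qed
  also have "\<dots> = sw (\<lambda>x z. sw (\<lambda>a b. f a b z) x) h"
    by (rule sweedler_assoc[OF T f h, symmetric])
  also have "\<dots> = sw (\<lambda>x z. sw (\<lambda>g1 g2. pure H H\<^sup>* (mul H z (mul H g2 k))
      (conv H \<phi> (dual_act H x (conv H \<psi> (dual_act H g1 \<chi>))))) g) h"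
  proof (rule tlift_cong[OF vspace Dh])
    fix x z assume x: "x \<in> carr H" and z: "z \<in> carr H"
    note Dx = comul_closed[OF x]
    have "sw (\<lambda>a b. f a b z) x = sw (\<lambda>g1 g2. sw (\<lambda>a b. pure H H\<^sup>* (mul H (mul H z g2) k)
      (conv H (conv H \<phi> (dual_act H a \<psi>)) (dual_act H (mul H b g1) \<chi>))) x) g"
      unfolding f_def by (rule tlift_swap)
    also have "\<dots> = sw (\<lambda>g1 g2. pure H H\<^sup>* (mul H z (mul H g2 k))
      (conv H \<phi> (dual_act H x (conv H \<psi> (dual_act H g1 \<chi>))))) g"
    proof (rule tlift_cong[OF vspace Dg])
      fix g1 g2 assume g1: "g1 \<in> carr H" and g2: "g2 \<in> carr H"
      have F: "lin_map H\<^sup>* HH (\<lambda>\<zeta>. pure H H\<^sup>* (mul H z (mul H g2 k)) (conv H \<phi> \<zeta>))"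
        by (intro lin_intros z g2 k p)
      have "sw (\<lambda>a b. pure H H\<^sup>* (mul H (mul H z g2) k)
          (conv H (conv H \<phi> (dual_act H a \<psi>)) (dual_act H (mul H b g1) \<chi>))) x
        = sw (\<lambda>a b. pure H H\<^sup>* (mul H z (mul H g2 k))
          (conv H \<phi> (conv H (dual_act H a \<psi>) (dual_act H b (dual_act H g1 \<chi>))))) x"
        by (rule tlift_cong[OF vspace Dx])
          (simp add: mul_assoc conv_assoc act_mul act_closed z g1 g2 k p q r)
      also have "\<dots> = pure H H\<^sup>* (mul H z (mul H g2 k))
          (conv H \<phi> (sw (\<lambda>a b. conv H (dual_act H a \<psi>) (dual_act H b (dual_act H g1 \<chi>))) x))"
        by (rule lin_map_apply_tlift[OF F vdual vspace Dx, symmetric]) (intro lin_intros q r g1)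
      also have "\<dots> = pure H H\<^sup>* (mul H z (mul H g2 k))
          (conv H \<phi> (dual_act H x (conv H \<psi> (dual_act H g1 \<chi>))))"
        by (simp add: act_conv[OF x q act_closed[OF g1 r]])
      finally show "sw (\<lambda>a b. pure H H\<^sup>* (mul H (mul H z g2) k)
          (conv H (conv H \<phi> (dual_act H a \<psi>)) (dual_act H (mul H b g1) \<chi>))) x = \<dots>" .
    qed
    finally show "sw (\<lambda>a b. f a b z) x = \<dots>" .
  qed
  also have "\<dots> = sw (\<lambda>g1 g2. smash h \<phi> (mul H g2 k) (conv H \<psi> (dual_act H g1 \<chi>))) g"
    unfolding smash_def by (rule tlift_swap)
  also have "\<dots> = sw (\<lambda>g1 g2. ?m (pure H H\<^sup>* h \<phi>)
      (pure H H\<^sup>* (mul H g2 k) (conv H \<psi> (dual_act H g1 \<chi>)))) g"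
    by (rule tlift_cong[OF vspace Dg], rule heisenberg_mul_pure[symmetric]) (simp_all add: lin_intros assms)
  also have "\<dots> = ?m (pure H H\<^sup>* h \<phi>) (smash g \<psi> k \<chi>)"
    unfolding smash_def
    by (rule lin_map_apply_tlift[OF mr[OF pure_closed[OF h p]] T vspace Dg, symmetric])
      (intro lin_intros assms)
  finally show ?thesis .
qed

text \<open>
  The twist in the product disappears when \<open>\<Delta>\<close> is applied to \<open>1\<close>, and when \<open>h\<^sub>(\<^sub>1\<^sub>)\<close> acts on \<open>\<epsilon>\<close>,
  which it merely multiplies by a scalar.  Hence \<open>h \<mapsto> h # \<epsilon>\<close> and \<open>\<phi> \<mapsto> 1 # \<phi>\<close> are algebra embeddings.
\<close>

lemma
  assumes h: "h \<in> carr H" and p: "\<phi> \<in> carr H\<^sup>*"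
  shows smash_right: "\<psi> \<in> carr H\<^sup>* \<Longrightarrow> smash (munit H) \<psi> h \<phi> = pure H H\<^sup>* h (conv H \<psi> \<phi>)"
    and smash_left: "g \<in> carr H \<Longrightarrow> smash h \<phi> g \<epsilon> = pure H H\<^sup>* (mul H h g) \<phi>"
proof -
  note T = is_vspace_tensor[of H "H\<^sup>*"]
  show "smash (munit H) \<psi> h \<phi> = pure H H\<^sup>* h (conv H \<psi> \<phi>)" if q: "\<psi> \<in> carr H\<^sup>*"
  proof -
    have "smash (munit H) \<psi> h \<phi> = pure H H\<^sup>* (mul H (munit H) h) (conv H \<psi> (dual_act H (munit H) \<phi>))"
      unfolding smash_def by (rule sweedler_munit[OF T]) (intro bilin_mapI lin_intros p q h)
    then show ?thesis by (simp add: munit_left act_unit h p)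
  qed
  show "smash h \<phi> g \<epsilon> = pure H H\<^sup>* (mul H h g) \<phi>" if g: "g \<in> carr H"
  proof -
    have l: "lin_map H HH (\<lambda>h. pure H H\<^sup>* (mul H h g) \<phi>)"
      by (intro lin_intros g p)
    have "smash h \<phi> g \<epsilon> = sw (\<lambda>h1 h2. fun_smul (counit H h1) (pure H H\<^sup>* (mul H h2 g) \<phi>)) h"
      unfolding smash_def
    proof (rule tlift_cong[OF vspace comul_closed[OF h]])
      fix x y assume x: "x \<in> carr H" and y: "y \<in> carr H"
      have "conv H \<phi> (fun_smul (counit H x) \<epsilon>) = fun_smul (counit H x) \<phi>"
        using lin_mapD(3)[OF conv_lin(2)[OF p] eps_closed] conv_eps(2)[OF p] by simp
      then show "pure H H\<^sup>* (mul H y g) (conv H \<phi> (dual_act H x \<epsilon>))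
          = fun_smul (counit H x) (pure H H\<^sup>* (mul H y g) \<phi>)"
        using pure_smul_right[of H "H\<^sup>*" "mul H y g" "counit H x" \<phi>] by (simp add: act_eps x)
    qed
    then show ?thesis
      using sweedler_counit_left[OF T l h] by simp
  qed
qed

lemma k_algebra_heisenberg: "k_algebra (heisenberg H)"
proof
  let ?m = "mul (heisenberg H)"
  note s = heisenberg_simps
  show "is_vspace (heisenberg H)"
    using is_vspace_tensor[of H "H\<^sup>*"] by (simp add: is_vspace_def s)
  note mb = heisenberg_mul_bilin
  show "bilin_map (heisenberg H) (heisenberg H) (heisenberg H) ?m"
    using mb by (simp add: bilin_map_def lin_map_def s)
  note l = lin_mapD(2)[OF bilin_mapD(2)[OF mb]] and r = lin_mapD(2)[OF bilin_mapD(1)[OF mb]]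
  have cl: "?m s t \<in> carr HH" if "s \<in> carr HH" "t \<in> carr HH" for s t
    using lin_mapD(1)[OF bilin_mapD(1)[OF mb]] that by blast
  show "?m (?m x y) z = ?m x (?m y z)"
    if "x \<in> carr (heisenberg H)" "y \<in> carr (heisenberg H)" "z \<in> carr (heisenberg H)" for x y z
  proof -
    have x: "x \<in> carr HH" and y: "y \<in> carr HH" and z: "z \<in> carr HH"
      using that by (simp_all add: s)
    from vspace vdual x show ?thesis
    proof (induction x rule: tensor_induct)
      case (pure a b)
      note ab = this
      from vspace vdual y show ?case
      proof (induction y rule: tensor_induct)
        case (pure c d)
        note cd = this
        from vspace vdual z show ?case
        proof (induction z rule: tensor_induct)
          case (pure e f)
          then show ?case using ab cd by (simp add: heisenberg_mul_pure heisenberg_assoc_pure)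
        next
          case (add s t)
          then show ?case using ab cd by (simp add: r cl pure_closed)
        qed
      next
        case (add s t)
        then show ?case using ab z by (simp add: l r cl pure_closed)
      qed
    next
      case (add s t)
      then show ?case using y z by (simp add: l cl)
    qed
  qed
  show 1: "munit (heisenberg H) \<in> carr (heisenberg H)"
    by (simp add: s pure_closed munit_closed eps_closed)
  show "?m (munit (heisenberg H)) x = x" if "x \<in> carr (heisenberg H)" for x
  proof -
    have x: "x \<in> carr HH" using that by (simp add: s)
    from vspace vdual x show ?thesis
    proof (induction x rule: tensor_induct)
      case (pure a b)
      then show ?case
        by (simp add: s heisenberg_mul_pure munit_closed eps_closed smash_right conv_eps)
    next
      case (add s t)
      then show ?case using 1 by (simp add: heisenberg_simps r)
    qed
  qed
  show "?m x (munit (heisenberg H)) = x" if "x \<in> carr (heisenberg H)" for x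
  proof -
    have x: "x \<in> carr HH" using that by (simp add: s)
    from vspace vdual x show ?thesis
    proof (induction x rule: tensor_induct)
      case (pure a b)
      then show ?case
        by (simp add: s heisenberg_mul_pure munit_closed eps_closed smash_left munit_right)
    next
      case (add s t)
      then show ?case using 1 by (simp add: heisenberg_simps l)
    qed
  qed
qed

end

section \<open>The canonical element and its inverse\<close>

lemma finite_dim_basis:
  assumes V: "is_vspace V" and fd: "finite_dim V"
  shows "\<exists>B. basis_of V B" and "basis_of V B \<Longrightarrow> finite B"
proof -
  interpret v: vector_space "smul V" by (rule is_vspaceD(1)[OF V])
  obtain E where E: "E \<subseteq> carr V" "\<not> v.dependent E" "carr V \<subseteq> v.span E"
    by (rule v.maximal_independent_subset)
  have "v.span E = carr V"
    using E(1,3) is_vspaceD(2)[OF V] by (simp add: subset_antisym v.span_minimal)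
  then show "\<exists>B. basis_of V B" using E(2) by (auto simp: basis_of_def)
  show "finite B" if "basis_of V B"
  proof -
    obtain C where C: "finite C" "v.span C = carr V" using fd by (auto simp: finite_dim_def)
    have "\<not> v.dependent B" "B \<subseteq> v.span C"
      using that v.span_superset[of B] C(2) by (auto simp: basis_of_def)
    then show ?thesis using v.independent_span_bound[OF C(1)] by blast
  qed
qed

locale fd_hopf_algebra = hopf_algebra H
  for H :: "('k::field, 'a::ab_group_add, 'm) hopf_scheme" +
  assumes fd: "finite_dim H"
begin

definition "B = (SOME B. basis_of H B)"

definition "coord e = (\<lambda>x. module.representation (smul H) B x e)"

lemma basis_B: "basis_of H B"
  unfolding B_def by (rule someI_ex[OF finite_dim_basis(1)[OF vspace fd]])

lemma finite_B: "finite B"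
  by (rule finite_dim_basis(2)[OF vspace fd basis_B])

lemma B_carr: "b \<in> B \<Longrightarrow> b \<in> carr H"
proof -
  interpret v: vector_space "smul H" by (rule is_vspaceD(1)[OF vspace])
  show "b \<in> B \<Longrightarrow> b \<in> carr H"
    using basis_B v.span_base[of b B] by (simp add: basis_of_def)
qed

lemma coord_dual: "coord e \<in> carr H\<^sup>*"
  and coord_basis: "b \<in> B \<Longrightarrow> coord e b = (if e = b then 1 else 0)"
  and expand: "x \<in> carr H \<Longrightarrow> (\<Sum>e\<in>B. smul H (coord e x) e) = x"
proof -
  interpret v: vector_space "smul H" by (rule is_vspaceD(1)[OF vspace])
  have B: "\<not> v.dependent B" "v.span B = carr H" using basis_B by (simp_all add: basis_of_def)
  show "coord e \<in> carr H\<^sup>*"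
    by (simp add: dual_def coord_def lin_map_def v.representation_add[OF B(1)]
        v.representation_scale[OF B(1)] B(2)) (simp add: v.representation_def B(2))
  show "coord e b = (if e = b then 1 else 0)" if "b \<in> B"
    by (simp add: coord_def v.representation_basis[OF B(1) that])
  assume x: "x \<in> carr H"
  have "(\<Sum>e\<in>B. smul H (coord e x) e) = (\<Sum>e | coord e x \<noteq> 0. smul H (coord e x) e)"
    using v.representation_ne_zero[of B x]
    by (intro sum.mono_neutral_right finite_B) (auto simp: coord_def)
  also have "\<dots> = x"
    unfolding coord_def by (rule v.sum_nonzero_representation_eq[OF B(1)]) (simp add: B(2) x)
  finally show "(\<Sum>e\<in>B. smul H (coord e x) e) = x" .
qed

lemma lin_map_expand:
  assumes "lin_map H U F" "x \<in> carr H"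
  shows "(\<Sum>e\<in>B. smul U (coord e x) (F e)) = F x"
proof -
  have "F x = F (\<Sum>e\<in>B. smul H (coord e x) e)" by (simp add: expand assms(2))
  also have "\<dots> = (\<Sum>e\<in>B. F (smul H (coord e x) e))"
    by (rule lin_map_sum[OF assms(1) vspace]) (intro vspace_closed(3)[OF vspace] B_carr)
  also have "\<dots> = (\<Sum>e\<in>B. smul U (coord e x) (F e))"
    by (intro sum.cong refl lin_mapD(3)[OF assms(1)] B_carr)
  finally show ?thesis ..
qed

lemma dual_expand:
  assumes p: "\<phi> \<in> carr H\<^sup>*"
  shows "(\<Sum>e\<in>B. fun_smul (\<phi> e) (coord e)) = \<phi>"
proof (rule dual_eqI[of _ H])
  have ap: "(\<Sum>e\<in>I. f e) x = (\<Sum>e\<in>I. f e x)" for I :: "'a set" and f :: "'a \<Rightarrow> 'a \<Rightarrow> 'k" and x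
    by (induction I rule: infinite_finite_induct) (simp_all add: fun_arith)
  show "(\<Sum>e\<in>B. fun_smul (\<phi> e) (coord e)) \<in> carr H\<^sup>*"
    using vspace_closed(3)[OF vdual coord_dual] by (intro vspace_closed(4)[OF vdual]) simp
  show "(\<Sum>e\<in>B. fun_smul (\<phi> e) (coord e)) x = \<phi> x" if "x \<in> carr H" for x
    using lin_map_expand[OF dualD(1)[OF p] that] by (simp add: ap fun_smul_def mult.commute)
qed (rule p)

abbreviation "A \<equiv> heisenberg H"
abbreviation "AA \<equiv> tensor A A"
abbreviation "mulA \<equiv> mul A"
abbreviation "mulAA \<equiv> mul (tensor_alg A A)"

interpretation A: k_algebra A by (rule k_algebra_heisenberg)
interpretation AA: k_algebra "tensor_alg A A" by (rule A.k_algebra_tensor_alg)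

definition "incl h = pure H H\<^sup>* h \<epsilon>"
definition "dincl \<phi> = pure H H\<^sup>* (munit H) \<phi>"

lemma lin_incl: "lin_map H A incl" and lin_dincl: "lin_map H\<^sup>* A dincl"
  unfolding incl_def dincl_def
  using bilin_mapD(2)[OF bilin_map_pure[of H "H\<^sup>*"] eps_closed]
    bilin_mapD(1)[OF bilin_map_pure[of H "H\<^sup>*"] munit_closed]
  by (simp_all add: lin_map_def heisenberg_simps)

lemmas incl_closed = lin_mapD(1)[OF lin_incl] and dincl_closed = lin_mapD(1)[OF lin_dincl]

lemma incl_mul: "g \<in> carr H \<Longrightarrow> h \<in> carr H \<Longrightarrow> mulA (incl g) (incl h) = incl (mul H g h)"
  by (simp add: incl_def heisenberg_mul_pure eps_closed smash_left)

lemma dincl_mul: "\<phi> \<in> carr H\<^sup>* \<Longrightarrow> \<psi> \<in> carr H\<^sup>* \<Longrightarrow> mulA (dincl \<phi>) (dincl \<psi>) = dincl (conv H \<phi> \<psi>)"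
  by (simp add: dincl_def heisenberg_mul_pure munit_closed smash_right)

lemma incl_dincl_unit: "incl (munit H) = munit A" "dincl \<epsilon> = munit A"
  by (simp_all add: incl_def dincl_def heisenberg_simps)

lemma dual_mul_incl: "\<phi> \<in> carr H\<^sup>* \<Longrightarrow> h \<in> carr H \<Longrightarrow> mulA (dincl \<phi>) (incl h) = pure H H\<^sup>* h \<phi>"
  by (simp add: incl_def dincl_def heisenberg_mul_pure munit_closed eps_closed smash_right conv_eps)

text \<open>
  The twist of the product is invisible on each of the two embedded copies.  It only shows when a vector
  of \<open>H\<close> is moved to the right past a functional.
\<close>

lemma incl_mul_dincl:
  assumes h: "h \<in> carr H" and p: "\<phi> \<in> carr H\<^sup>*"
  shows "mulA (incl h) (dincl \<phi>) = sw (\<lambda>h1 h2. mulA (dincl (dual_act H h1 \<phi>)) (incl h2)) h"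
proof -
  have "mulA (incl h) (dincl \<phi>) = smash h \<epsilon> (munit H) \<phi>"
    by (simp add: incl_def dincl_def heisenberg_mul_pure munit_closed eps_closed h p)
  also have "\<dots> = sw (\<lambda>h1 h2. mulA (dincl (dual_act H h1 \<phi>)) (incl h2)) h"
    unfolding smash_def
    by (rule tlift_cong[OF vspace comul_closed[OF h]])
      (simp add: dual_mul_incl act_closed p munit_right conv_eps)
  finally show ?thesis .
qed

text \<open>
  The image of \<open>F\<close> under \<open>Hom(H,H) \<cong> H \<otimes> H\<^sup>* \<subseteq> (H # H\<^sup>*) \<otimes> (H # H\<^sup>*)\<close>.  Under this map convolution of
  linear maps becomes multiplication of tensors (\<open>canon_mul\<close>), and the canonical element is the image of
  the identity.
\<close>

definition "canon F = (\<Sum>e\<in>B. pure A A (incl (F e)) (dincl (coord e)))"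

lemma canonical_element_canon: "canonical_element H = canon (\<lambda>x. x)"
  unfolding canonical_element_def canon_def incl_def dincl_def coord_def B_def[symmetric] by (simp add: Let_def)

lemma canon_cong: "(\<And>x. x \<in> carr H \<Longrightarrow> F x = G x) \<Longrightarrow> canon F = canon G"
  unfolding canon_def by (intro sum.cong refl) (simp add: B_carr)

lemma canon_closed: "lin_map H H F \<Longrightarrow> canon F \<in> carr AA"
  unfolding canon_def
  by (intro vspace_closed(4)[OF is_vspace_tensor] pure_closed incl_closed dincl_closed coord_dual
      lin_mapD(1)[of H H F] B_carr)

text \<open>
  Expanding each \<open>\<phi> p\<close> in the dual basis identifies the linear map that belongs to an arbitrary element
  \<open>\<Sum> x\<^sub>p \<otimes> \<phi>\<^sub>p\<close> of \<open>H \<otimes> H\<^sup>*\<close>, namely \<open>y \<mapsto> \<Sum> \<phi>\<^sub>p(y) x\<^sub>p\<close>.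
\<close>

lemma canon_sum:
  assumes x: "\<And>p. p \<in> P \<Longrightarrow> x p \<in> carr H" and \<phi>: "\<And>p. p \<in> P \<Longrightarrow> \<phi> p \<in> carr H\<^sup>*"
  shows "(\<Sum>p\<in>P. pure A A (incl (x p)) (dincl (\<phi> p))) = canon (\<lambda>y. \<Sum>p\<in>P. smul H (\<phi> p y) (x p))"
proof -
  note pl = lin_map_sum[OF bilin_mapD(2)[OF bilin_map_pure] A.vspace]
  note pr = lin_map_sum[OF bilin_mapD(1)[OF bilin_map_pure] A.vspace]
  note sA = vspace_closed(3)[OF A.vspace, unfolded heisenberg_simps(2)]
  have "pure A A (incl (x p)) (dincl (\<phi> p)) = (\<Sum>e\<in>B. pure A A (incl (smul H (\<phi> p e) (x p))) (dincl (coord e)))"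
    if p: "p \<in> P" for p
  proof -
    have "dincl (\<phi> p) = dincl (\<Sum>e\<in>B. fun_smul (\<phi> p e) (coord e))"
      by (simp add: dual_expand \<phi> p)
    also have "\<dots> = (\<Sum>e\<in>B. dincl (fun_smul (\<phi> p e) (coord e)))"
      using vspace_closed(3)[OF vdual coord_dual] by (intro lin_map_sum[OF lin_dincl vdual]) simp
    also have "\<dots> = (\<Sum>e\<in>B. smul A (\<phi> p e) (dincl (coord e)))"
      using lin_mapD(3)[OF lin_dincl coord_dual] by simp
    finally have "pure A A (incl (x p)) (dincl (\<phi> p)) = (\<Sum>e\<in>B. pure A A (incl (x p)) (smul A (\<phi> p e) (dincl (coord e))))"
      by (simp add: pr[OF incl_closed[OF x[OF p]]] vspace_closed(3)[OF A.vspace] dincl_closed coord_dual)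
    also have "\<dots> = (\<Sum>e\<in>B. pure A A (smul A (\<phi> p e) (incl (x p))) (dincl (coord e)))"
      unfolding pure_smul_left pure_smul_right ..
    also have "\<dots> = (\<Sum>e\<in>B. pure A A (incl (smul H (\<phi> p e) (x p))) (dincl (coord e)))"
      by (simp add: lin_mapD(3)[OF lin_incl x[OF p]])
    finally show ?thesis .
  qed
  then have "(\<Sum>p\<in>P. pure A A (incl (x p)) (dincl (\<phi> p)))
      = (\<Sum>p\<in>P. \<Sum>e\<in>B. pure A A (incl (smul H (\<phi> p e) (x p))) (dincl (coord e)))"
    by (intro sum.cong) auto
  also have "\<dots> = (\<Sum>e\<in>B. \<Sum>p\<in>P. pure A A (incl (smul H (\<phi> p e) (x p))) (dincl (coord e)))"
    by (rule sum.swap)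
  also have "\<dots> = (\<Sum>e\<in>B. pure A A (incl (\<Sum>p\<in>P. smul H (\<phi> p e) (x p))) (dincl (coord e)))"
    by (intro sum.cong refl)
      (simp add: lin_map_sum[OF lin_incl vspace] pl[OF dincl_closed[OF coord_dual]] vspace_closed(3)[OF vspace]
        x incl_closed)
  finally show ?thesis by (simp add: canon_def)
qed

lemma mulAA_pure:
  "\<lbrakk>a \<in> carr A; b \<in> carr A; a' \<in> carr A; b' \<in> carr A\<rbrakk> \<Longrightarrow>
    mulAA (pure A A a b) (pure A A a' b') = pure A A (mulA a a') (mulA b b')"
  by (rule A.tensor_alg_mul_pure)

text \<open>
  By \<open>canon_sum\<close>, the product \<open>\<Sum> F(e) G(d) \<otimes> e\<^sup>* d\<^sup>*\<close> belongs to the map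
  \<open>y \<mapsto> \<Sum> e\<^sup>*(y\<^sub>(\<^sub>1\<^sub>)) d\<^sup>*(y\<^sub>(\<^sub>2\<^sub>)) F(e) G(d) = \<Sum> F(y\<^sub>(\<^sub>1\<^sub>)) G(y\<^sub>(\<^sub>2\<^sub>))\<close>.
\<close>

lemma canon_mul:
  assumes F: "lin_map H H F" and G: "lin_map H H G"
  shows "mulAA (canon F) (canon G) = canon (\<lambda>x. sw (\<lambda>u v. mul H (F u) (G v)) x)"
proof -
  note Fc = lin_mapD(1)[OF F] and Gc = lin_mapD(1)[OF G]
  note l = lin_map_sum[OF AA.mul_lin_left AA.vspace, unfolded A.tensor_alg_simps]
  note r = lin_map_sum[OF AA.mul_lin_right AA.vspace, unfolded A.tensor_alg_simps]
  have cl: "pure A A (incl (F e)) (dincl (coord e)) \<in> carr AA" "pure A A (incl (G e)) (dincl (coord e)) \<in> carr AA"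
    if "e \<in> B" for e
    using that by (simp_all add: pure_closed incl_closed dincl_closed coord_dual Fc Gc B_carr)
  have "mulAA (canon F) (canon G) = (\<Sum>e\<in>B. mulAA (pure A A (incl (F e)) (dincl (coord e))) (canon G))"
    using l[OF canon_closed[OF G] cl(1)] by (simp add: canon_def[of F])
  also have "\<dots> = (\<Sum>e\<in>B. \<Sum>d\<in>B. mulAA (pure A A (incl (F e)) (dincl (coord e))) (pure A A (incl (G d)) (dincl (coord d))))"
    unfolding canon_def[of G] by (rule sum.cong[OF refl], rule r) (rule cl; assumption)+
  also have "\<dots> = (\<Sum>e\<in>B. \<Sum>d\<in>B. pure A A (incl (mul H (F e) (G d))) (dincl (conv H (coord e) (coord d))))"
    by (intro sum.cong refl)
      (simp add: mulAA_pure incl_closed dincl_closed coord_dual Fc Gc B_carr incl_mul dincl_mul)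
  also have "\<dots> = (\<Sum>(e, d)\<in>B \<times> B. pure A A (incl (mul H (F e) (G d))) (dincl (conv H (coord e) (coord d))))"
    by (rule sum.cartesian_product)
  also have "\<dots> = canon (\<lambda>y. \<Sum>p\<in>B \<times> B. smul H (conv H (coord (fst p)) (coord (snd p)) y) (mul H (F (fst p)) (G (snd p))))"
    unfolding case_prod_unfold
    by (rule canon_sum) (auto simp: mul_closed conv_closed coord_dual Fc Gc B_carr)
  also have "\<dots> = canon (\<lambda>x. sw (\<lambda>u v. mul H (F u) (G v)) x)"
  proof (rule canon_cong)
    fix y assume y: "y \<in> carr H"
    note D = comul_closed[OF y] and vs = is_vspaceD(1)[OF vspace]
    have sc: "smul H (tlift H H f t) z = tlift H H (\<lambda>u v. smul H (f u v) z) t"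
      if "t \<in> carr (tensor H H)" "z \<in> carr H" for f t z
    proof -
      have "lin_map base_field H (\<lambda>c. smul H c z)"
        by (intro lin_mapI) (simp_all add: smul_simps[OF vs] vspace_closed[OF vspace] that(2))
      from lin_map_apply_tlift[OF this is_vspace_base_field vspace that(1)] show ?thesis by simp
    qed
    have "(\<Sum>p\<in>B \<times> B. smul H (conv H (coord (fst p)) (coord (snd p)) y) (mul H (F (fst p)) (G (snd p))))
      = (\<Sum>e\<in>B. \<Sum>d\<in>B. smul H (conv H (coord e) (coord d) y) (mul H (F e) (G d)))"
      by (simp add: sum.cartesian_product case_prod_unfold)
    also have "\<dots> = (\<Sum>e\<in>B. \<Sum>d\<in>B. sw (\<lambda>u v. smul H (coord e u * coord d v) (mul H (F e) (G d))) y)"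
      by (intro sum.cong refl) (simp add: conv_apply y sc[OF D] mul_closed Fc Gc B_carr)
    also have "\<dots> = sw (\<lambda>u v. \<Sum>e\<in>B. \<Sum>d\<in>B. smul H (coord e u * coord d v) (mul H (F e) (G d))) y"
      by (simp add: tlift_sum)
    also have "\<dots> = sw (\<lambda>u v. mul H (F u) (G v)) y"
    proof (rule tlift_cong[OF vspace D])
      fix u v assume u: "u \<in> carr H" and v: "v \<in> carr H"
      have "(\<Sum>e\<in>B. \<Sum>d\<in>B. smul H (coord e u * coord d v) (mul H (F e) (G d)))
        = (\<Sum>e\<in>B. smul H (coord e u) (\<Sum>d\<in>B. smul H (coord d v) (mul H (F e) (G d))))"
        by (simp add: smul_sum[OF vs] smul_simps[OF vs])
      also have "\<dots> = (\<Sum>e\<in>B. smul H (coord e u) (mul H (F e) (G v)))"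
        by (intro sum.cong refl arg_cong[where f = "smul H _"]
            lin_map_expand[OF lin_map_mul_right[OF G Fc[OF B_carr]] v])
      also have "\<dots> = mul H (F u) (G v)"
        by (rule lin_map_expand[OF lin_map_mul_left[OF F Gc[OF v]] u])
      finally show "(\<Sum>e\<in>B. \<Sum>d\<in>B. smul H (coord e u * coord d v) (mul H (F e) (G d))) = mul H (F u) (G v)" .
    qed
    finally show "(\<Sum>p\<in>B \<times> B. smul H (conv H (coord (fst p)) (coord (snd p)) y) (mul H (F (fst p)) (G (snd p))))
      = sw (\<lambda>u v. mul H (F u) (G v)) y" .
  qed
  finally show ?thesis .
qed

lemma canon_unit: "canon (\<lambda>x. smul H (counit H x) (munit H)) = munit (tensor_alg A A)"
proof -
  \<comment> \<open>A single pure tensor, read as a sum over a one-point set.\<close>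
  have "(\<Sum>p\<in>{()}. pure A A (incl (munit H)) (dincl \<epsilon>))
      = canon (\<lambda>y. \<Sum>p\<in>{()}. smul H (\<epsilon> y) (munit H))"
    by (rule canon_sum) (simp_all add: munit_closed eps_closed)
  also have "\<dots> = canon (\<lambda>x. smul H (counit H x) (munit H))"
    by (rule canon_cong) (simp add: eps_apply)
  finally show ?thesis by (simp add: A.tensor_alg_simps incl_dincl_unit)
qed

abbreviation "R \<equiv> canon (\<lambda>x. x)"
abbreviation "R' \<equiv> canon (antipode H)"

text \<open>
  The antipode is the convolution inverse of the identity.
\<close>

lemma R_inverse: "mulAA R R' = munit (tensor_alg A A)" "mulAA R' R = munit (tensor_alg A A)"
proof -
  show "mulAA R R' = munit (tensor_alg A A)"
    unfolding canon_mul[OF lin_map_id antipode_lin] canon_unit[symmetric]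
    by (rule canon_cong) (rule antipode_right)
  show "mulAA R' R = munit (tensor_alg A A)"
    unfolding canon_mul[OF antipode_lin lin_map_id] canon_unit[symmetric]
    by (rule canon_cong) (rule antipode_left)
qed

lemma tensor_inv_R: "tensor_inv A R = R'"
  by (intro A.tensor_inv_eq canon_closed lin_map_id antipode_lin R_inverse)

text \<open>
  Pushing \<open>h\<close> to the right through the second tensor factor of \<open>R\<close> gives
  \<open>\<Sum> e \<otimes> h e\<^sup>* = \<Sum> e \<otimes> (h\<^sub>(\<^sub>1\<^sub>) \<cdot> e\<^sup>*) h\<^sub>(\<^sub>2\<^sub>)\<close>, and \<open>\<Sum> e \<otimes> h\<^sub>(\<^sub>1\<^sub>) \<cdot> e\<^sup>*\<close> belongs to the map \<open>c \<mapsto> c h\<^sub>(\<^sub>1\<^sub>)\<close>,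
  just as \<open>\<Sum> e h\<^sub>(\<^sub>1\<^sub>) \<otimes> e\<^sup>*\<close> does.
\<close>

lemma R_intertwines:
  assumes h: "h \<in> carr H"
  shows "mulAA (pure A A (munit A) (incl h)) R = mulAA R (sw (\<lambda>u v. pure A A (incl u) (incl v)) h)"
proof -
  note D = comul_closed[OF h]
  note ic = incl_closed and jc = dincl_closed and T = is_vspace_tensor[of A A] and uc = A.munit_closed
  note l = lin_map_sum[OF AA.mul_lin_left AA.vspace, unfolded A.tensor_alg_simps]
  note r = lin_map_sum[OF AA.mul_lin_right AA.vspace, unfolded A.tensor_alg_simps]
  have Rc: "R \<in> carr AA" by (rule canon_closed[OF lin_map_id])
  have Rcl: "pure A A (incl e) (dincl (coord e)) \<in> carr AA" if "e \<in> B" for e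
    using that by (simp add: pure_closed ic jc coord_dual B_carr)
  have "mulAA (pure A A (munit A) (incl h)) R = (\<Sum>e\<in>B. mulAA (pure A A (munit A) (incl h)) (pure A A (incl e) (dincl (coord e))))"
    using r[OF pure_closed[OF uc ic[OF h]] Rcl] by (simp add: canon_def)
  also have "\<dots> = (\<Sum>e\<in>B. sw (\<lambda>h1 h2. mulAA (pure A A (incl e) (dincl (dual_act H h1 (coord e)))) (pure A A (munit A) (incl h2))) h)"
  proof (rule sum.cong[OF refl])
    fix e assume "e \<in> B"
    then have e: "incl e \<in> carr A" by (simp add: ic B_carr)
    have "mulAA (pure A A (munit A) (incl h)) (pure A A (incl e) (dincl (coord e)))
        = pure A A (incl e) (sw (\<lambda>h1 h2. mulA (dincl (dual_act H h1 (coord e))) (incl h2)) h)"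
      by (simp add: mulAA_pure uc ic jc coord_dual e h A.munit_left incl_mul_dincl)
    also have "\<dots> = sw (\<lambda>h1 h2. pure A A (incl e) (mulA (dincl (dual_act H h1 (coord e))) (incl h2))) h"
      by (rule lin_map_apply_tlift[OF bilin_mapD(1)[OF bilin_map_pure e] A.vspace vspace D])
        (intro A.mul_closed ic jc act_closed coord_dual)
    also have "\<dots> = sw (\<lambda>h1 h2. mulAA (pure A A (incl e) (dincl (dual_act H h1 (coord e)))) (pure A A (munit A) (incl h2))) h"
      by (rule tlift_cong[OF vspace D])
        (simp add: mulAA_pure uc ic jc act_closed coord_dual e A.munit_right)
    finally show "mulAA (pure A A (munit A) (incl h)) (pure A A (incl e) (dincl (coord e))) = \<dots>" .
  qed
  also have "\<dots> = sw (\<lambda>h1 h2. \<Sum>e\<in>B. mulAA (pure A A (incl e) (dincl (dual_act H h1 (coord e)))) (pure A A (munit A) (incl h2))) h"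
    by (simp add: tlift_sum)
  also have "\<dots> = sw (\<lambda>h1 h2. mulAA R (pure A A (incl h1) (incl h2))) h"
  proof (rule tlift_cong[OF vspace D])
    fix x y assume x: "x \<in> carr H" and y: "y \<in> carr H"
    note xy = pure_closed[OF uc ic[OF y]]
    have "(\<Sum>e\<in>B. pure A A (incl e) (dincl (dual_act H x (coord e))))
        = canon (\<lambda>c. \<Sum>e\<in>B. smul H (dual_act H x (coord e) c) e)"
      by (rule canon_sum) (simp_all add: act_closed coord_dual x B_carr)
    also have "\<dots> = canon (\<lambda>c. mul H c x)"
      by (rule canon_cong) (simp add: act_apply x mul_closed expand)
    also have "\<dots> = (\<Sum>e\<in>B. mulAA (pure A A (incl e) (dincl (coord e))) (pure A A (incl x) (munit A)))"
      unfolding canon_def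
      by (intro sum.cong refl) (simp add: mulAA_pure ic jc uc coord_dual B_carr x incl_mul A.munit_right)
    also have "\<dots> = mulAA R (pure A A (incl x) (munit A))"
      unfolding canon_def by (rule l[OF pure_closed[OF ic[OF x] uc] Rcl, symmetric])
    finally have Rx: "(\<Sum>e\<in>B. pure A A (incl e) (dincl (dual_act H x (coord e))))
        = mulAA R (pure A A (incl x) (munit A))" .
    have "(\<Sum>e\<in>B. mulAA (pure A A (incl e) (dincl (dual_act H x (coord e)))) (pure A A (munit A) (incl y)))
        = mulAA (\<Sum>e\<in>B. pure A A (incl e) (dincl (dual_act H x (coord e)))) (pure A A (munit A) (incl y))"
      by (rule l[OF xy, symmetric]) (intro pure_closed ic jc act_closed coord_dual x B_carr)
    also have "\<dots> = mulAA R (mulAA (pure A A (incl x) (munit A)) (pure A A (munit A) (incl y)))"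
      unfolding Rx
      by (rule AA.mul_assoc; unfold A.tensor_alg_simps; intro Rc pure_closed ic uc x y)
    also have "\<dots> = mulAA R (pure A A (incl x) (incl y))"
      by (simp add: mulAA_pure ic uc x y A.munit_left A.munit_right)
    finally show "(\<Sum>e\<in>B. mulAA (pure A A (incl e) (dincl (dual_act H x (coord e)))) (pure A A (munit A) (incl y)))
        = mulAA R (pure A A (incl x) (incl y))" .
  qed
  also have "\<dots> = mulAA R (sw (\<lambda>u v. pure A A (incl u) (incl v)) h)"
    by (rule lin_map_apply_tlift[OF bilin_mapD(1)[OF A.tensor_alg_mul_bilin Rc] T vspace D, symmetric])
      (intro pure_closed ic)
  finally show ?thesis .
qed

section \<open>Slices of the canonical element\<close>

text \<open>
  \<open>slice \<alpha>\<close> is \<open>id \<otimes> \<alpha>\<close>.  On tensors in the image of \<open>canon\<close> it only depends on the vector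
  \<open>slice_point \<alpha>\<close> of \<open>H\<close> that corresponds to the functional \<open>\<alpha> \<circ> dincl\<close> on \<open>H\<^sup>*\<close>.
\<close>

definition "slice \<alpha> t = tlift A A (\<lambda>r1 r2. smul A (\<alpha> r2) r1) t"
definition "slice_point \<alpha> = (\<Sum>e\<in>B. smul H (\<alpha> (dincl (coord e))) e)"

lemma slice_point_closed: "slice_point \<alpha> \<in> carr H"
  unfolding slice_point_def by (intro vspace_closed(3,4)[OF vspace] B_carr)

lemma slice_bilin: "\<alpha> \<in> carr (dual A) \<Longrightarrow> bilin_map A A A (\<lambda>r1 r2. smul A (\<alpha> r2) r1)"
  by (rule bilin_map_smul(2)[OF A.vspace A.vspace dualD(1)])

lemma slice_canon:
  assumes a: "\<alpha> \<in> carr (dual A)" and F: "lin_map H H F"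
  shows "slice \<alpha> (canon F) = incl (F (slice_point \<alpha>))"
proof -
  note Fi = lin_map_compose[OF F lin_incl]
  have "slice \<alpha> (canon F) = (\<Sum>e\<in>B. slice \<alpha> (pure A A (incl (F e)) (dincl (coord e))))"
    unfolding slice_def canon_def
    by (rule lin_map_sum[OF lin_map_tlift[OF A.vspace A.vspace A.vspace slice_bilin[OF a]] is_vspace_tensor])
      (intro pure_closed incl_closed dincl_closed coord_dual lin_mapD(1)[OF F] B_carr)
  also have "\<dots> = (\<Sum>e\<in>B. smul A (\<alpha> (dincl (coord e))) (incl (F e)))"
    unfolding slice_def
    by (intro sum.cong refl tlift_pure[OF A.vspace A.vspace A.vspace slice_bilin[OF a]]
        incl_closed dincl_closed coord_dual lin_mapD(1)[OF F] B_carr)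
  also have "\<dots> = (\<Sum>e\<in>B. incl (F (smul H (\<alpha> (dincl (coord e))) e)))"
    by (intro sum.cong refl lin_mapD(3)[OF Fi, symmetric] B_carr)
  also have "\<dots> = incl (F (slice_point \<alpha>))"
    unfolding slice_point_def
    by (rule lin_map_sum[OF Fi vspace, symmetric]) (intro vspace_closed(3)[OF vspace] B_carr)
  finally show ?thesis .
qed

text \<open>
  The unit of the Heisenberg double is \<open>dincl \<epsilon>\<close>, so \<open>\<alpha>(1)\<close> is the value of \<open>\<alpha> \<circ> dincl\<close> at \<open>\<epsilon>\<close>.
\<close>

lemma counit_slice_point:
  assumes a: "\<alpha> \<in> carr (dual A)"
  shows "counit H (slice_point \<alpha>) = \<alpha> (munit A)"
proof -
  note jl = lin_map_compose[OF lin_dincl dualD(1)[OF a]]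
  have "counit H (slice_point \<alpha>) = (\<Sum>e\<in>B. \<alpha> (dincl (coord e)) * counit H e)"
    unfolding slice_point_def
    by (subst lin_map_sum[OF counit_lin vspace])
      (simp_all add: vspace_closed(3)[OF vspace] B_carr lin_mapD(3)[OF counit_lin])
  also have "\<dots> = (\<Sum>e\<in>B. \<alpha> (dincl (fun_smul (\<epsilon> e) (coord e))))"
    using lin_mapD(3)[OF jl coord_dual]
    by (intro sum.cong refl) (simp add: eps_apply B_carr mult.commute)
  also have "\<dots> = \<alpha> (dincl (\<Sum>e\<in>B. fun_smul (\<epsilon> e) (coord e)))"
    using vspace_closed(3)[OF vdual coord_dual] by (intro lin_map_sum[OF jl vdual, symmetric]) simp
  also have "\<dots> = \<alpha> (munit A)"
    by (simp add: dual_expand eps_closed incl_dincl_unit)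
  finally show ?thesis .
qed

text \<open>
  A functional on \<open>H # H\<^sup>*\<close> that extends evaluation at \<open>h\<close> on the copy of \<open>H\<^sup>*\<close>; hence every
  vector \<open>h\<close> is of the form \<open>slice_point \<alpha>\<close>.
\<close>

definition "ev h = on_carr A (tlift H H\<^sup>* (\<lambda>g \<phi>. counit H g * \<phi> h))"

lemma ev_dual: "ev h \<in> carr (dual A)" and ev_dincl: "\<phi> \<in> carr H\<^sup>* \<Longrightarrow> ev h (dincl \<phi>) = \<phi> h"
proof -
  have b: "bilin_map H H\<^sup>* base_field (\<lambda>g \<phi>. counit H g * \<phi> h)"
    using lin_mapD[OF counit_lin]
    by (intro bilin_mapI lin_mapI) (simp_all add: fun_arith fun_smul_def algebra_simps)
  note t = lin_map_tlift[OF vspace vdual is_vspace_base_field b]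
  show "ev h \<in> carr (dual A)"
    unfolding ev_def using t by (intro on_carr_dual A.vspace) (simp add: lin_map_def heisenberg_simps)
  show "ev h (dincl \<phi>) = \<phi> h" if "\<phi> \<in> carr H\<^sup>*"
    using dincl_closed[OF that] that
    by (simp add: ev_def on_carr_def dincl_def tlift_pure[OF vspace vdual is_vspace_base_field b]
        munit_closed counit_munit)
qed

lemma slice_point_ev: "h \<in> carr H \<Longrightarrow> slice_point (ev h) = h"
  by (simp add: slice_point_def ev_dincl coord_dual expand)

definition "retract = tlift H H\<^sup>* (\<lambda>g \<phi>. smul H (\<phi> (munit H)) g)"

lemma retract_lin: "lin_map A H retract" and ret_incl: "h \<in> carr H \<Longrightarrow> retract (incl h) = h"
proof -
  have b: "bilin_map H H\<^sup>* H (\<lambda>g \<phi>. smul H (\<phi> (munit H)) g)"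
    by (rule bilin_map_smul(2)[OF vdual vspace lin_map_eval])
  note t = lin_map_tlift[OF vspace vdual vspace b]
  show "lin_map A H retract"
    using t by (simp add: lin_map_def heisenberg_simps retract_def)
  show "retract (incl h) = h" if "h \<in> carr H"
    using that by (simp add: retract_def incl_def tlift_pure[OF vspace vdual vspace b] eps_closed
        eps_apply munit_closed counit_munit smul_simps[OF is_vspaceD(1)[OF vspace]])
qed

lemma left_leg_R: "carr (left_leg A R) = incl ` carr H"
proof -
  have "carr (left_leg A R) = {slice \<alpha> R | \<alpha>. \<alpha> \<in> carr (dual A)}"
    by (simp add: left_leg_def slice_def)
  also have "\<dots> = {incl (slice_point \<alpha>) | \<alpha>. \<alpha> \<in> carr (dual A)}"
    using slice_canon[OF _ lin_map_id] by (metis (no_types, lifting))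
  also have "\<dots> = incl ` carr H"
    using slice_point_closed ev_dual slice_point_ev by (auto simp: image_iff) metis
  finally show ?thesis .
qed

lemma slice_decomp:
  assumes "decomp A A R xs" "\<alpha> \<in> carr (dual A)"
  shows "slice \<alpha> R = (\<Sum>(x, y)\<leftarrow>xs. smul A (\<alpha> y) x)"
  using assms(1) tlift_tsum[OF A.vspace A.vspace A.vspace slice_bilin[OF assms(2)], of xs]
  by (simp add: decomp_def slice_def)

text \<open>
  In a representation \<open>R = \<Sum> a\<^sub>n \<otimes> b\<^sub>n\<close> that admits functionals \<open>\<beta>\<^sub>n\<close> dual to the \<open>b\<^sub>n\<close>, the vector \<open>a\<^sub>n\<close>
  is the slice of \<open>R\<close> along \<open>\<beta>\<^sub>n\<close>.  Values prescribed at the \<open>a\<^sub>n\<close> thus become values prescribed at slices.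
\<close>

lemma slice_dual_family:
  assumes xs: "decomp A A R xs" and f: "dual_family A (map snd xs) \<beta>s" and n: "n < length xs"
  shows "\<beta>s ! n \<in> carr (dual A)" and "slice (\<beta>s ! n) R = fst (xs ! n)"
proof -
  note s = smul_simps[OF is_vspaceD(1)[OF A.vspace]]
  show b: "\<beta>s ! n \<in> carr (dual A)"
    using f n by (auto simp: dual_family_def)
  have "slice (\<beta>s ! n) R = (\<Sum>m<length xs. smul A ((\<beta>s ! n) (snd (xs ! m))) (fst (xs ! m)))"
    by (simp add: slice_decomp[OF xs b] case_prod_unfold sum_list_sum_nth atLeast0LessThan)
  also have "\<dots> = (\<Sum>m<length xs. if m = n then fst (xs ! m) else 0)"
    using f n by (intro sum.cong refl) (simp add: dual_family_def s)
  also have "\<dots> = fst (xs ! n)" using n by simp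
  finally show "slice (\<beta>s ! n) R = fst (xs ! n)" .
qed

text \<open>
  Minimality is a rank argument: the slices of \<open>R\<close> exhaust the copy of \<open>H\<close>, and they lie in the span of
  the first components of any representation of \<open>R\<close>, so there are at least \<open>dim H\<close> of these.
\<close>

lemma canonical_min_decomp:
  assumes bs: "distinct bs" "set bs = B"
  shows "min_decomp A R (map (\<lambda>b. (incl b, dincl (coord b))) bs)"
  unfolding min_decomp_def
proof (intro conjI allI impI)
  show "decomp A A R (map (\<lambda>b. (incl b, dincl (coord b))) bs)"
    using bs by (auto simp: decomp_def tsum_def canon_def comp_def sum_list_distinct_conv_sum_set
        intro!: incl_closed dincl_closed coord_dual B_carr)
  fix ys assume ys: "decomp A A R ys"
  interpret v: vector_space "smul H" by (rule is_vspaceD(1)[OF vspace])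
  have "h \<in> v.span (set (map (\<lambda>p. retract (fst p)) ys))" if h: "h \<in> carr H" for h
  proof -
    have "h = retract (slice (ev h) R)"
      using slice_canon[OF ev_dual lin_map_id] by (simp add: slice_point_ev ret_incl h)
    also have "\<dots> = (\<Sum>p\<leftarrow>ys. retract (smul A (ev h (snd p)) (fst p)))"
      unfolding slice_decomp[OF ys ev_dual] case_prod_unfold
      using ys by (intro lin_map_sum_list[OF retract_lin A.vspace] vspace_closed(3)[OF A.vspace])
        (auto simp: decomp_def)
    also have "\<dots> = (\<Sum>p\<leftarrow>ys. smul H (ev h (snd p)) (retract (fst p)))"
      using ys by (intro arg_cong[where f = sum_list] map_cong refl lin_mapD(3)[OF retract_lin])
        (auto simp: decomp_def)
    also have "\<dots> \<in> v.span (set (map (\<lambda>p. retract (fst p)) ys))"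
    proof -
      have "(\<Sum>p\<leftarrow>zs. smul H (c p) (retract (fst p))) \<in> v.span (set (map (\<lambda>p. retract (fst p)) ys))"
        if "set zs \<subseteq> set ys" for zs c
        using that
        by (induction zs) (auto intro!: v.span_add v.span_scale intro: v.span_base v.span_zero)
      from this[OF subset_refl] show ?thesis .
    qed
    finally show ?thesis .
  qed
  then have "card B \<le> card (set (map (\<lambda>p. retract (fst p)) ys))"
    using v.independent_span_bound[of "set (map (\<lambda>p. retract (fst p)) ys)" B] basis_B B_carr
    by (auto simp: basis_of_def)
  also have "\<dots> \<le> length ys" using card_length[of "map (\<lambda>p. retract (fst p)) ys"] by simp
  finally show "length (map (\<lambda>b. (incl b, dincl (coord b))) bs) \<le> length ys"
    using distinct_card[OF bs(1)] bs(2) by simp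
qed

lemma canonical_dual_family:
  assumes bs: "distinct bs" "set bs = B"
  shows "dual_family A (map snd (map (\<lambda>b. (incl b, dincl (coord b))) bs)) (map ev bs)"
  using bs nth_mem[of _ bs]
  by (auto simp: dual_family_def ev_dual ev_dincl coord_dual coord_basis nth_eq_iff_index_eq)

text \<open>
  The common form of the counit and the antipode of \<open>P(A,R)\<close>.  A linear map \<open>g\<close> on \<open>H\<close>, carried over
  to the left leg, has the prescribed values as soon as \<open>val \<beta> = g (slice_point \<beta>)\<close>, by
  \<open>slice_dual_family\<close>.  It is the only such map because the canonical representation of \<open>R\<close> is minimal
  and its first components are a basis of the left leg.
\<close>

lemma the_map_on_leg:
  fixes W :: "('k, 'c::ab_group_add, 'p) vspace_scheme"
  assumes W: "is_vspace W" and g: "lin_map H W g"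
    and val: "\<And>\<beta>. \<beta> \<in> carr (dual A) \<Longrightarrow> val \<beta> = g (slice_point \<beta>)"
  shows "(THE e. lin_map (left_leg A R) W e \<and> (\<forall>x. x \<notin> carr (left_leg A R) \<longrightarrow> e x = 0) \<and>
     (\<forall>xs \<beta>s. min_decomp A R xs \<and> dual_family A (map snd xs) \<beta>s \<longrightarrow>
        (\<forall>n<length xs. e (fst (xs ! n)) = val (\<beta>s ! n))))
    = (\<lambda>x. if x \<in> incl ` carr H then g (retract x) else 0)" (is "The ?P = ?g")
proof (rule the_equality)
  have gi: "?g (incl h) = g h" if "h \<in> carr H" for h
    using that by (simp add: ret_incl)
  have il: "incl x + incl y = incl (x + y)" "smul A c (incl x) = incl (smul H c x)"
    if "x \<in> carr H" "y \<in> carr H" for x y c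
    using lin_mapD(2,3)[OF lin_incl] that by simp_all
  have sl: "smul (left_leg A R) = smul A" by (simp add: left_leg_def)
  note cl = vspace_closed(2,3)[OF vspace]
  show "?P ?g"
  proof (intro conjI allI impI)
    show "lin_map (left_leg A R) W ?g"
    proof (rule lin_mapI; unfold left_leg_R sl)
      show "?g x \<in> carr W" if "x \<in> incl ` carr H" for x
        using that gi lin_mapD(1)[OF g] by auto
      show "?g (x + y) = ?g x + ?g y" if xy: "x \<in> incl ` carr H" "y \<in> incl ` carr H" for x y
      proof -
        obtain a b where ab: "a \<in> carr H" "b \<in> carr H" "x = incl a" "y = incl b" using xy by blast
        show ?thesis unfolding ab(3,4) il(1)[OF ab(1,2)]
          using ab(1,2) cl lin_mapD(2)[OF g] by (simp only: gi)
      qed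
      show "?g (smul A c x) = smul W c (?g x)" if x: "x \<in> incl ` carr H" for c x
      proof -
        obtain a where a: "a \<in> carr H" "x = incl a" using x by blast
        show ?thesis unfolding a(2) il(2)[OF a(1) a(1)]
          using a(1) cl lin_mapD(3)[OF g] by (simp only: gi)
      qed
    qed
    show "?g x = 0" if "x \<notin> carr (left_leg A R)" for x
      using that by (simp add: left_leg_R)
    fix xs \<beta>s n assume m: "min_decomp A R xs \<and> dual_family A (map snd xs) \<beta>s" and n: "n < length xs"
    then have d: "decomp A A R xs" "dual_family A (map snd xs) \<beta>s" by (simp_all add: min_decomp_def)
    note b = slice_dual_family(1)[OF d n]
    have "fst (xs ! n) = incl (slice_point (\<beta>s ! n))"
      using slice_dual_family(2)[OF d n] slice_canon[OF b lin_map_id] by simp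
    then show "?g (fst (xs ! n)) = val (\<beta>s ! n)"
      by (simp only: gi[OF slice_point_closed] val[OF b])
  qed
  fix e assume e: "?P e"
  obtain bs where bs: "distinct bs" "set bs = B"
    using finite_distinct_list[OF finite_B] by blast
  have eb: "e (incl b) = g b" if b: "b \<in> B" for b
  proof -
    obtain n where n: "n < length bs" "bs ! n = b" using b[folded bs(2), unfolded in_set_conv_nth] by blast
    let ?xs = "map (\<lambda>b. (incl b, dincl (coord b))) bs"
    have "\<forall>n<length ?xs. e (fst (?xs ! n)) = val (map ev bs ! n)"
      using e canonical_min_decomp[OF bs] canonical_dual_family[OF bs] by blast
    then have "e (fst (?xs ! n)) = val (map ev bs ! n)"
      using n(1) by simp
    then show ?thesis using n val[OF ev_dual] by (simp add: slice_point_ev B_carr b)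
  qed
  have ei: "lin_map H W (\<lambda>h. e (incl h))"
  proof (rule lin_map_compose[of H "left_leg A R" incl W e])
    show "lin_map H (left_leg A R) incl"
      using lin_incl by (simp add: lin_map_def left_leg_R sl)
    show "lin_map (left_leg A R) W e" using e by blast
  qed
  show "e = ?g"
  proof
    fix x
    show "e x = ?g x"
    proof (cases "x \<in> incl ` carr H")
      case True
      then obtain h where h: "h \<in> carr H" "x = incl h" by blast
      have "e x = (\<Sum>b\<in>B. smul W (coord b h) (e (incl b)))"
        using lin_map_expand[OF ei h(1)] h(2) by simp
      also have "\<dots> = (\<Sum>b\<in>B. smul W (coord b h) (g b))"
        by (intro sum.cong refl) (simp add: eb)
      also have "\<dots> = ?g x"
        unfolding lin_map_expand[OF g h(1)] h(2) by (rule gi[OF h(1), symmetric])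
      finally show ?thesis .
    next
      case False
      then show ?thesis using e by (simp add: left_leg_R)
    qed
  qed
qed

section \<open>The isomorphism\<close>

lemma P_counit_R: "h \<in> carr H \<Longrightarrow> P_counit A R (incl h) = counit H h"
  unfolding P_counit_def
  by (subst the_map_on_leg[OF is_vspace_base_field counit_lin, of "\<lambda>\<beta>. \<beta> (munit A)"])
    (simp_all add: counit_slice_point ret_incl)

lemma P_antipode_R: "h \<in> carr H \<Longrightarrow> P_antipode A R (incl h) = incl (antipode H h)"
  unfolding P_antipode_def
  by (subst the_map_on_leg[OF A.vspace lin_map_compose[OF antipode_lin lin_incl],
        of "\<lambda>\<beta>. tlift A A (\<lambda>u1 u2. smul A (\<beta> u2) u1) (tensor_inv A R)"])
    (simp_all add: tensor_inv_R slice_canon[OF _ antipode_lin, unfolded slice_def] ret_incl)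

text \<open>
  \<open>R\<^sup>-\<^sup>1 (1 \<otimes> h) R = R\<^sup>-\<^sup>1 R \<Delta>(h) = \<Delta>(h)\<close>, by \<open>R_intertwines\<close>.
\<close>

lemma P_comul_R:
  assumes h: "h \<in> carr H"
  shows "mulAA (mulAA (tensor_inv A R) (pure A A (munit A) (incl h))) R
    = sw (\<lambda>u v. pure A A (incl u) (incl v)) h"
proof -
  note c = canon_closed[OF lin_map_id] canon_closed[OF antipode_lin]
    pure_closed[OF A.munit_closed incl_closed[OF h]]
  have D: "sw (\<lambda>u v. pure A A (incl u) (incl v)) h \<in> carr AA"
    by (rule tlift_closed[OF vspace is_vspace_tensor comul_closed[OF h]]) (intro pure_closed incl_closed)
  note as = AA.mul_assoc[unfolded A.tensor_alg_simps]
  have "mulAA (mulAA R' (pure A A (munit A) (incl h))) R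
      = mulAA R' (mulAA R (sw (\<lambda>u v. pure A A (incl u) (incl v)) h))"
    by (simp add: as c R_intertwines h)
  also have "\<dots> = mulAA (mulAA R' R) (sw (\<lambda>u v. pure A A (incl u) (incl v)) h)"
    by (simp add: as c D)
  also have "\<dots> = sw (\<lambda>u v. pure A A (incl u) (incl v)) h"
    using AA.munit_left D by (simp add: R_inverse A.tensor_alg_simps)
  finally show ?thesis by (simp add: tensor_inv_R)
qed

lemma hopf_iso_P: "hopf_iso H (P_hopf A R) incl"
proof -
  let ?K = "P_hopf A R"
  have s: "carr ?K = incl ` carr H" "smul ?K = smul A" "mul ?K = mulA" "munit ?K = munit A"
    by (simp_all add: P_hopf_def left_leg_R)
  \<comment> \<open>A pure tensor depends on the ambient scalar multiplication only, not on the carrier.\<close>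
  have p: "pure ?K ?K = pure A A"
    by (simp add: pure_def fun_eq_iff bilin_form_def s)
  have ops: "comul ?K (incl h) = sw (\<lambda>u v. pure A A (incl u) (incl v)) h"
    "counit ?K (incl h) = counit H h" "antipode ?K (incl h) = incl (antipode H h)" if "h \<in> carr H" for h
    using that by (simp_all add: P_hopf_def P_comul_R P_counit_R P_antipode_R)
  show ?thesis
    unfolding hopf_iso_def
  proof (intro conjI ballI)
    show "lin_map H ?K incl" using lin_incl by (simp add: lin_map_def s)
    show "bij_betw incl (carr H) (carr ?K)"
      unfolding s by (intro inj_on_imp_bij_betw inj_on_inverseI[of _ retract] ret_incl)
  qed (simp_all add: s p ops incl_mul incl_dincl_unit)
qed

end

theorem theorem3p1:
  fixes L :: "('k::field, 'a::ab_group_add) hopf"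
  assumes "hopf_algebra L" and "finite_dim L"
  shows "hopf_algebra (P_hopf (heisenberg L) (canonical_element L)) \<and>
    (\<exists>f. hopf_iso L (P_hopf (heisenberg L) (canonical_element L)) f)"
proof -
  interpret fd_hopf_algebra L
    using assms by (simp add: fd_hopf_algebra_def fd_hopf_algebra_axioms_def)
  note iso = hopf_iso_P[folded canonical_element_canon]
  have "vector_space (smul (P_hopf (heisenberg L) (canonical_element L)))"
    by (simp add: P_hopf_def heisenberg_simps vector_space_fun_smul)
  from hopf_algebra_transport[OF assms(1) iso this] iso show ?thesis by blast
qed

end
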